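(* Let $f:M^m\to\mathbb{R}^{m+1}$ be a weakly convex translating soliton on a connected manifold $M^m$, i.e. its scalar second fundamental form $A$ is positive semidefinite everywhere. If the Gauss–Kronecker curvature $\det A$ vanishes at some point of $M^m$, then it vanishes everywhere on $M^m$.
   Context: A translating soliton is an immersion $f:M^m\to\mathbb{R}^{m+1}$ of an oriented manifold with unit normal $\xi$ whose scalar mean curvature $H=\operatorname{trace}A$ (where $A(v,w)=-\langle\vec A(v,w),\xi\rangle$, $\vec A$ the second fundamental form) satisfies $H=-\langle\operatorname{v},\xi\rangle$ with $\operatorname{v}=\operatorname{e}_{m+1}$. The Gauss–Kronecker curvature is the determinant of the Weingarten operator associated with $A$ (the product of the principal curvatures). *)

theory Defs
  imports "HOL-Analysis.Analysis" "HOL-Library.Numeral_Type"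
begin

definition partial :: "(real^'m \<Rightarrow> 'b::real_normed_vector) \<Rightarrow> 'm \<Rightarrow> real^'m \<Rightarrow> 'b" where
  "partial F i x = frechet_derivative F (at x) (axis i 1)"

fun dpart :: "(real^'m \<Rightarrow> 'b::real_normed_vector) \<Rightarrow> 'm list \<Rightarrow> real^'m \<Rightarrow> 'b" where
  "dpart F [] = F"
| "dpart F (i # is) = partial (dpart F is) i"

definition smooth_on :: "(real^'m) set \<Rightarrow> (real^'m \<Rightarrow> 'b::real_normed_vector) \<Rightarrow> bool" where
  "smooth_on W F \<longleftrightarrow> open W \<and>
     (\<forall>is. continuous_on W (dpart F is) \<and> (\<forall>x\<in>W. dpart F is differentiable (at x)))"

definition smooth_atlas :: "('a::topological_space set \<times> ('a \<Rightarrow> real^'m)) set \<Rightarrow> bool" where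
  "smooth_atlas \<A> \<longleftrightarrow>
     (\<Union>(U,\<phi>)\<in>\<A>. U) = UNIV \<and>
     (\<forall>(U,\<phi>)\<in>\<A>. open U \<and> open (\<phi> ` U) \<and> homeomorphism U (\<phi> ` U) \<phi> (inv_into U \<phi>)) \<and>
     (\<forall>(U,\<phi>)\<in>\<A>. \<forall>(V,\<psi>)\<in>\<A>. smooth_on (\<phi> ` (U \<inter> V)) (\<psi> \<circ> inv_into U \<phi>))"

definition connected_manifold :: "('a::{t2_space,second_countable_topology} set \<times> ('a \<Rightarrow> real^'m)) set \<Rightarrow> bool" where
  "connected_manifold \<A> \<longleftrightarrow> smooth_atlas \<A> \<and> connected (UNIV :: 'a set)"

definition oriented_immersion ::
  "('a::topological_space set \<times> ('a \<Rightarrow> real^'m)) set \<Rightarrow> ('a \<Rightarrow> real^('m + 1)) \<Rightarrow> ('a \<Rightarrow> real^('m + 1)) \<Rightarrow> bool" where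
  "oriented_immersion \<A> f \<xi> \<longleftrightarrow>
     (\<forall>(U,\<phi>)\<in>\<A>. smooth_on (\<phi> ` U) (f \<circ> inv_into U \<phi>) \<and>
        (\<forall>x\<in>\<phi> ` U. inj (frechet_derivative (f \<circ> inv_into U \<phi>) (at x)) \<and>
           (\<forall>i. partial (f \<circ> inv_into U \<phi>) i x \<bullet> \<xi> (inv_into U \<phi> x) = 0))) \<and>
     continuous_on UNIV \<xi> \<and> (\<forall>p. norm (\<xi> p) = 1)"

definition metric_mat ::
  "('a set \<times> ('a \<Rightarrow> real^'m)) \<Rightarrow> ('a \<Rightarrow> real^('m + 1)) \<Rightarrow> real^'m \<Rightarrow> real^'m^'m" where
  "metric_mat C f x = (case C of (U,\<phi>) \<Rightarrow>
     (\<chi> i j. partial (f \<circ> inv_into U \<phi>) i x \<bullet> partial (f \<circ> inv_into U \<phi>) j x))"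

text \<open>Scalar second fundamental form A(v,w) = - < vec A(v,w), xi > in the chart (U, phi).\<close>
definition sff_mat ::
  "('a set \<times> ('a \<Rightarrow> real^'m)) \<Rightarrow> ('a \<Rightarrow> real^('m + 1)) \<Rightarrow> ('a \<Rightarrow> real^('m + 1)) \<Rightarrow> real^'m \<Rightarrow> real^'m^'m" where
  "sff_mat C f \<xi> x = (case C of (U,\<phi>) \<Rightarrow>
     (\<chi> i j. - (partial (partial (f \<circ> inv_into U \<phi>) j) i x \<bullet> \<xi> (inv_into U \<phi> x))))"

definition weingarten_mat where
  "weingarten_mat C f \<xi> x = matrix_inv (metric_mat C f x) ** sff_mat C f \<xi> x"

definition mean_curv where
  "mean_curv C f \<xi> x = trace (weingarten_mat C f \<xi> x)"

definition gauss_kronecker where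
  "gauss_kronecker C f \<xi> x = det (weingarten_mat C f \<xi> x)"

definition e_last :: "real^('m::finite + 1)" where
  "e_last = axis (Inr 1) 1"

definition translating_soliton where
  "translating_soliton \<A> f \<xi> \<longleftrightarrow> oriented_immersion \<A> f \<xi> \<and>
     (\<forall>(U,\<phi>)\<in>\<A>. \<forall>p\<in>U. mean_curv (U,\<phi>) f \<xi> (\<phi> p) = - (e_last \<bullet> \<xi> p))"

definition weakly_convex where
  "weakly_convex \<A> f \<xi> \<longleftrightarrow>
     (\<forall>(U,\<phi>)\<in>\<A>. \<forall>p\<in>U. \<forall>v. 0 \<le> v \<bullet> (sff_mat (U,\<phi>) f \<xi> (\<phi> p) *v v))"

end

theory Submission
  imports Defs
begin

text \<open>Locally the soliton is the graph of a function \<open>u\<close> over a tangent hyperplane, its second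
  fundamental form is a positive multiple of the Hessian of \<open>u\<close>, and \<open>u\<close> solves the quasilinear
  elliptic equation \<open>(1 + |Du|^2) tr(D^2 u) - D^2 u(Du, Du) = (1 + |Du|^2) (c0 + c \<bullet> Du)\<close>.
  Differentiating it twice in the direction of an eigenvector of the smallest eigenvalue of
  \<open>D^2 u\<close> shows that this eigenvalue is a supersolution, in the barrier sense, of a linear elliptic
  equation. Since it is nonnegative, Hopf's boundary point argument makes its zero set open. The
  zero set of the Gauss-Kronecker curvature is therefore open and closed in the manifold.\<close>

section \<open>Calculus of iterated partial derivatives\<close>

text \<open>The normal is only continuous, so it is never differentiated. Frozen at a point as a
  constant vector, it turns the immersion into a scalar function that is critical at that point, and
  the Hessian at a critical point transforms by congruence under a change of variables. This one
  fact makes degeneracy independent of the chart and expresses the second fundamental form by the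
  Hessian of the graph function. The smallest eigenvalue l has no smooth eigenvector field, so a
  unit vector e is frozen as well: D^2 u(e, e) is a smooth function of the point that lies above l.
  It can replace l because the coefficients of the graph equation depend on Du alone. Where e is an
  eigenvector, Du moves along e with velocity l e, so that a derivative falling on a coefficient
  costs a factor l or a first derivative of D^2 u(e, e). The remaining coefficient of l has no sign;
  at the point of comparison l is nonnegative and bounded by the barrier, which absorbs this
  term.\<close>

lemma partial_eq:
  assumes "(F has_derivative F') (at x)"
  shows "partial F i x = F' (axis i 1)"
  unfolding partial_def using frechet_derivative_at[OF assms] by simp

lemma partial_cong:
  assumes "open W" "x \<in> W" "\<And>y. y \<in> W \<Longrightarrow> F y = G y"
  shows "partial F i x = partial G i x"
proof -
  have "(F has_derivative D) (at x) = (G has_derivative D) (at x)" for D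
    using has_derivative_transform_within_open[OF _ assms(1,2)] assms(3) by metis
  then show ?thesis unfolding partial_def frechet_derivative_def by simp
qed

lemma frechet_derivative_eq_sum_partial:
  fixes F :: "real^'m \<Rightarrow> 'b::real_normed_vector"
  assumes "F differentiable (at x)"
  shows "frechet_derivative F (at x) v = (\<Sum>i\<in>UNIV. v $ i *\<^sub>R partial F i x)"
proof -
  have lin: "linear (frechet_derivative F (at x))"
    using assms linear_frechet_derivative by blast
  have "v = (\<Sum>i\<in>UNIV. v $ i *\<^sub>R axis i 1)"
    by (simp add: vec_eq_iff axis_def sum.delta if_distrib[of "\<lambda>z. _ * z"] cong: if_cong)
  then have "frechet_derivative F (at x) v = frechet_derivative F (at x) (\<Sum>i\<in>UNIV. v $ i *\<^sub>R axis i 1)"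
    by simp
  also have "\<dots> = (\<Sum>i\<in>UNIV. v $ i *\<^sub>R partial F i x)"
    unfolding partial_def by (simp add: linear_sum[OF lin] linear_cmul[OF lin])
  finally show ?thesis .
qed

lemma has_derivative_sum_partial:
  fixes F :: "real^'m \<Rightarrow> 'b::real_normed_vector"
  assumes "F differentiable (at x)"
  shows "(F has_derivative (\<lambda>v. \<Sum>i\<in>UNIV. v $ i *\<^sub>R partial F i x)) (at x)"
proof -
  have "frechet_derivative F (at x) = (\<lambda>v. \<Sum>i\<in>UNIV. v $ i *\<^sub>R partial F i x)"
    using frechet_derivative_eq_sum_partial[OF assms] by blast
  then show ?thesis using assms frechet_derivative_works by metis
qed

text \<open>Differentiability up to order n, recursing on the derivative taken first, whereas
  \<open>dpart\<close> adds the one taken last. The product, quotient and chain rules express a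
  partial derivative by sums and products of functions that are differentiable to order n, so with
  this recursion the closure rules below go by induction on n.\<close>

fun diff_upto :: "nat \<Rightarrow> (real^'m) set \<Rightarrow> (real^'m \<Rightarrow> 'b::real_normed_vector) \<Rightarrow> bool" where
  "diff_upto 0 W F \<longleftrightarrow> (\<forall>x\<in>W. F differentiable (at x))"
| "diff_upto (Suc n) W F \<longleftrightarrow> (\<forall>x\<in>W. F differentiable (at x)) \<and> (\<forall>i. diff_upto n W (partial F i))"

lemma diff_upto_differentiable: "diff_upto n W F \<Longrightarrow> x \<in> W \<Longrightarrow> F differentiable (at x)"
  by (cases n) auto

lemma diff_upto_SucD: "diff_upto (Suc n) W F \<Longrightarrow> diff_upto n W F"
  by (induction n arbitrary: F) auto

lemma differentiable_transform_open:
  assumes "F differentiable (at x)" "open W" "x \<in> W" "\<And>y. y \<in> W \<Longrightarrow> F y = G y"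
  shows "G differentiable (at x)"
  using assms has_derivative_transform_within_open unfolding differentiable_def by metis

lemma diff_upto_cong:
  assumes "open W" "\<And>x. x \<in> W \<Longrightarrow> F x = G x" "diff_upto n W F"
  shows "diff_upto n W G"
  using assms(2,3)
proof (induction n arbitrary: F G)
  case 0
  then show ?case using differentiable_transform_open[OF _ assms(1)] by (metis diff_upto.simps(1))
next
  case (Suc n)
  have "diff_upto n W (partial G i)" for i
    using Suc.IH[of "partial F i" "partial G i"] Suc.prems partial_cong[OF assms(1), of _ F G] by simp
  moreover have "G differentiable (at x)" if "x \<in> W" for x
    using Suc.prems differentiable_transform_open[OF _ assms(1) that] that by (metis diff_upto.simps(2))
  ultimately show ?case by simp
qed

lemma diff_upto_subset: "diff_upto n W F \<Longrightarrow> V \<subseteq> W \<Longrightarrow> diff_upto n V F"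
  by (induction n arbitrary: F) auto

lemma dpart_snoc: "dpart F (is @ [i]) = dpart (partial F i) is"
  by (induction "is") auto

lemma diff_upto_iff_dpart:
  "diff_upto n W F \<longleftrightarrow> (\<forall>is. length is \<le> n \<longrightarrow> (\<forall>x\<in>W. dpart F is differentiable (at x)))"
proof (induction n arbitrary: F)
  case 0
  then show ?case by simp
next
  case (Suc n)
  show ?case
  proof
    assume L: "diff_upto (Suc n) W F"
    show "\<forall>is. length is \<le> Suc n \<longrightarrow> (\<forall>x\<in>W. dpart F is differentiable (at x))"
    proof (intro allI impI ballI)
      fix "is" :: "'a list" and x assume "length is \<le> Suc n" "x \<in> W"
      then show "dpart F is differentiable (at x)"
        using L Suc.IH by (cases "is" rule: rev_cases) (auto simp: dpart_snoc)
    qed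
  next
    assume R: "\<forall>is. length is \<le> Suc n \<longrightarrow> (\<forall>x\<in>W. dpart F is differentiable (at x))"
    have "dpart (partial F i) is differentiable (at x)" if "length is \<le> n" "x \<in> W" for i "is" x
      using R[rule_format, of "is @ [i]" x] that by (simp add: dpart_snoc)
    moreover have "F differentiable (at x)" if "x \<in> W" for x
      using R[rule_format, of "[]" x] that by simp
    ultimately show "diff_upto (Suc n) W F" using Suc.IH by simp
  qed
qed

lemma smooth_on_iff_diff_upto: "smooth_on W F \<longleftrightarrow> open W \<and> (\<forall>n. diff_upto n W F)"
proof -
  have "continuous_on W (dpart F is)" if "\<forall>x\<in>W. dpart F is differentiable (at x)" for "is"
    using that by (meson continuous_at_imp_continuous_on differentiable_imp_continuous_within)
  then show ?thesis unfolding smooth_on_def diff_upto_iff_dpart by blast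
qed

lemma smooth_on_partial: "smooth_on W F \<Longrightarrow> smooth_on W (partial F i)"
  unfolding smooth_on_iff_diff_upto by (metis diff_upto.simps(2))

lemma smooth_on_differentiable: "smooth_on W F \<Longrightarrow> x \<in> W \<Longrightarrow> F differentiable (at x)"
  unfolding smooth_on_iff_diff_upto by (metis diff_upto_differentiable)

lemma smooth_on_continuous_on: "smooth_on W F \<Longrightarrow> continuous_on W F"
  by (metis smooth_on_def dpart.simps(1))

lemma smooth_on_subset: "smooth_on W F \<Longrightarrow> open V \<Longrightarrow> V \<subseteq> W \<Longrightarrow> smooth_on V F"
  unfolding smooth_on_iff_diff_upto using diff_upto_subset by blast

lemma partial_const [simp]: "partial (\<lambda>x. c) i = (\<lambda>x. 0)"
  using partial_eq[OF has_derivative_const] by fastforce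

lemma diff_upto_const: "diff_upto n W (\<lambda>x. c)"
  by (induction n arbitrary: c) auto

lemma partial_add:
  assumes "F differentiable (at x)" "G differentiable (at x)"
  shows "partial (\<lambda>x. F x + G x) i x = partial F i x + partial G i x"
  unfolding partial_def by (metis assms frechet_derivative_works has_derivative_add frechet_derivative_at)

lemma partial_mult:
  fixes F G :: "real^'m \<Rightarrow> real"
  assumes "F differentiable (at x)" "G differentiable (at x)"
  shows "partial (\<lambda>x. F x * G x) i x = partial F i x * G x + F x * partial G i x"
proof -
  have "((\<lambda>x. F x * G x) has_derivative
     (\<lambda>h. F x * frechet_derivative G (at x) h + frechet_derivative F (at x) h * G x)) (at x)"
    using assms frechet_derivative_works has_derivative_mult by blast
  from partial_eq[OF this] show ?thesis by (simp add: partial_def)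
qed

lemma partial_inner_const:
  assumes "F differentiable (at x)"
  shows "partial (\<lambda>x. F x \<bullet> c) i x = partial F i x \<bullet> c"
proof -
  have "((\<lambda>x. F x \<bullet> c) has_derivative (\<lambda>h. frechet_derivative F (at x) h \<bullet> c)) (at x)"
    using assms frechet_derivative_works has_derivative_inner_left by blast
  from partial_eq[OF this] show ?thesis by (simp add: partial_def)
qed

lemma diff_upto_add:
  assumes "open W" "diff_upto n W F" "diff_upto n W G"
  shows "diff_upto n W (\<lambda>x. F x + G x)"
  using assms(2,3)
proof (induction n arbitrary: F G)
  case 0 then show ?case by auto
next
  case (Suc n)
  have "diff_upto n W (partial (\<lambda>x. F x + G x) i)" for i
    by (rule diff_upto_cong[OF assms(1) _ Suc.IH[of "partial F i" "partial G i"]])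
       (use Suc.prems in \<open>auto simp: partial_add\<close>)
  then show ?case using Suc.prems by auto
qed

lemma diff_upto_mult:
  fixes F G :: "real^'m \<Rightarrow> real"
  assumes "open W" "diff_upto n W F" "diff_upto n W G"
  shows "diff_upto n W (\<lambda>x. F x * G x)"
  using assms(2,3)
proof (induction n arbitrary: F G)
  case 0 then show ?case by auto
next
  case (Suc n)
  have *: "diff_upto n W F" "diff_upto n W G" using Suc.prems diff_upto_SucD by blast+
  have "diff_upto n W (partial (\<lambda>x. F x * G x) i)" for i
    by (rule diff_upto_cong[OF assms(1) _ diff_upto_add[OF assms(1) Suc.IH[of "partial F i" G] Suc.IH[of F "partial G i"]]])
       (use Suc.prems * in \<open>auto simp: partial_mult\<close>)
  then show ?case using Suc.prems by auto
qed

lemma diff_upto_inner_const: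
  assumes "open W" "diff_upto n W F"
  shows "diff_upto n W (\<lambda>x. F x \<bullet> c)"
  using assms(2)
proof (induction n arbitrary: F)
  case 0 then show ?case by auto
next
  case (Suc n)
  have "diff_upto n W (partial (\<lambda>x. F x \<bullet> c) i)" for i
    by (rule diff_upto_cong[OF assms(1) _ Suc.IH[of "partial F i"]])
       (use Suc.prems in \<open>auto simp: partial_inner_const\<close>)
  then show ?case using Suc.prems by auto
qed

text \<open>The derivative of 1/F again contains 1/F, which the induction hypothesis covers because
  \<open>F\<close> is also differentiable to the lower order.\<close>

lemma diff_upto_inverse:
  fixes F :: "real^'m \<Rightarrow> real"
  assumes "open W" "diff_upto n W F" "\<And>x. x \<in> W \<Longrightarrow> F x \<noteq> 0"
  shows "diff_upto n W (\<lambda>x. inverse (F x))"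
  using assms(2,3)
proof (induction n arbitrary: F)
  case 0 then show ?case by (auto intro: differentiable_inverse)
next
  case (Suc n)
  have F: "diff_upto n W F" using Suc.prems diff_upto_SucD by blast
  have inv: "diff_upto n W (\<lambda>x. inverse (F x))" using Suc.IH[OF F] Suc.prems(2) by blast
  have eq: "partial (\<lambda>x. inverse (F x)) i x = (-1) * (inverse (F x) * (inverse (F x) * partial F i x))" if "x \<in> W" for x i
  proof -
    have "(F has_derivative frechet_derivative F (at x)) (at x)"
      using Suc.prems that frechet_derivative_works by auto
    then have "((\<lambda>x. inverse (F x)) has_derivative
       (\<lambda>h. - (inverse (F x) * frechet_derivative F (at x) h * inverse (F x)))) (at x)"
      using Suc.prems(2)[OF that] by (intro Deriv.has_derivative_inverse)
    from partial_eq[OF this] show ?thesis by (simp add: partial_def)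
  qed
  have "diff_upto n W (partial (\<lambda>x. inverse (F x)) i)" for i
  proof (rule diff_upto_cong[OF assms(1)])
    show "diff_upto n W (\<lambda>x. (-1) * (inverse (F x) * (inverse (F x) * partial F i x)))"
      using Suc.prems(1) by (intro diff_upto_mult[OF assms(1)] diff_upto_const inv) simp
  qed (simp add: eq)
  then show ?case using Suc.prems by (auto intro: differentiable_inverse)
qed

lemma diff_upto_sum:
  assumes "open W" "finite I" "\<And>i. i \<in> I \<Longrightarrow> diff_upto n W (F i)"
  shows "diff_upto n W (\<lambda>x. \<Sum>i\<in>I. F i x)"
  using assms(2,3) by (induction I rule: finite_induct) (auto intro: diff_upto_const diff_upto_add[OF assms(1)])

lemma diff_upto_prod:
  fixes F :: "'i \<Rightarrow> real^'m \<Rightarrow> real"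
  assumes "open W" "finite I" "\<And>i. i \<in> I \<Longrightarrow> diff_upto n W (F i)"
  shows "diff_upto n W (\<lambda>x. \<Prod>i\<in>I. F i x)"
  using assms(2,3) by (induction I rule: finite_induct) (auto intro: diff_upto_const diff_upto_mult[OF assms(1)])

lemma diff_upto_det:
  fixes M :: "real^'m \<Rightarrow> real^'n^'n"
  assumes "open W" "\<And>i j. diff_upto n W (\<lambda>x. M x $ i $ j)"
  shows "diff_upto n W (\<lambda>x. det (M x))"
  unfolding det_def
  by (intro diff_upto_sum[OF assms(1)] diff_upto_mult[OF assms(1)] diff_upto_const
        diff_upto_prod[OF assms(1)] assms(2)) (auto simp: finite_permutations)

lemma differentiable_vec:
  fixes T :: "'a::real_normed_vector \<Rightarrow> real^'k"
  assumes "\<And>k. (\<lambda>y. T y $ k) differentiable (at y)"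
  shows "T differentiable (at y)"
proof -
  have "(\<lambda>x. T x \<bullet> b) differentiable (at y)" if "b \<in> Basis" for b
    using that assms by (auto simp: Basis_vec_def inner_axis)
  then show ?thesis using differentiable_componentwise_within[of T y UNIV] by blast
qed

lemma partial_nth:
  fixes T :: "real^'m \<Rightarrow> real^'k"
  assumes "T differentiable (at y)"
  shows "partial (\<lambda>y. T y $ k) i y = partial T i y $ k"
  using partial_inner_const[OF assms, of "axis k 1" i] by (simp add: inner_axis)

lemma partial_compose:
  fixes T :: "real^'m \<Rightarrow> real^'k" and F :: "real^'k \<Rightarrow> 'b::real_normed_vector"
  assumes "T differentiable (at y)" "F differentiable (at (T y))"
  shows "partial (\<lambda>y. F (T y)) i y = (\<Sum>k\<in>UNIV. partial (\<lambda>y. T y $ k) i y *\<^sub>R partial F k (T y))"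
proof -
  have "((\<lambda>y. F (T y)) has_derivative (\<lambda>h. \<Sum>k\<in>UNIV. (frechet_derivative T (at y) h) $ k *\<^sub>R partial F k (T y))) (at y)"
    using assms(1) frechet_derivative_works
    by (intro has_derivative_compose[where f=T, OF _ has_derivative_sum_partial[OF assms(2)]]) blast
  from partial_eq[OF this] show ?thesis
    by (simp add: partial_nth[OF assms(1)]) (simp add: partial_def)
qed

lemma diff_upto_compose:
  fixes T :: "real^'m \<Rightarrow> real^'k" and F :: "real^'k \<Rightarrow> real"
  assumes "open V" "T ` V \<subseteq> W" "\<And>k. diff_upto n V (\<lambda>y. T y $ k)" "diff_upto n W F"
  shows "diff_upto n V (\<lambda>y. F (T y))"
  using assms(3,4)
proof (induction n arbitrary: F)
  case 0
  then have "T differentiable (at y)" if "y \<in> V" for y using that by (auto intro!: differentiable_vec)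
  then have "(F \<circ> T) differentiable (at y)" if "y \<in> V" for y
    using 0 assms(2) that by (intro differentiable_chain_at) auto
  then show ?case by (simp add: o_def)
next
  case (Suc n)
  have T: "T differentiable (at y)" if "y \<in> V" for y using that Suc.prems by (auto intro!: differentiable_vec)
  have F: "F differentiable (at (T y))" if "y \<in> V" for y using Suc.prems(2) assms(2) that by auto
  have S: "diff_upto n V (\<lambda>y. T y $ k)" for k using Suc.prems(1) diff_upto_SucD by blast
  have "diff_upto n V (partial (\<lambda>y. F (T y)) i)" for i
  proof (rule diff_upto_cong[OF assms(1)])
    show "diff_upto n V (\<lambda>y. \<Sum>k\<in>UNIV. partial (\<lambda>y. T y $ k) i y * partial F k (T y))"
      using Suc.prems Suc.IH[OF S] by (intro diff_upto_sum[OF assms(1)] diff_upto_mult[OF assms(1)]) auto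
  qed (simp add: partial_compose[OF T F])
  moreover have "(F \<circ> T) differentiable (at y)" if "y \<in> V" for y
    using T F that by (intro differentiable_chain_at) auto
  ultimately show ?case by (simp add: o_def)
qed

lemma smooth_on_compose:
  fixes T :: "real^'m \<Rightarrow> real^'k" and F :: "real^'k \<Rightarrow> real"
  assumes "open V" "T ` V \<subseteq> W" "\<And>k. smooth_on V (\<lambda>y. T y $ k)" "smooth_on W F"
  shows "smooth_on V (\<lambda>y. F (T y))"
  using assms(3,4) diff_upto_compose[OF assms(1,2)] assms(1) unfolding smooth_on_iff_diff_upto by simp

lemma partial_sum:
  assumes "finite I" "\<And>k. k \<in> I \<Longrightarrow> F k differentiable (at x)"
  shows "partial (\<lambda>x. \<Sum>k\<in>I. F k x) i x = (\<Sum>k\<in>I. partial (F k) i x)"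
proof -
  have "((\<lambda>x. \<Sum>k\<in>I. F k x) has_derivative (\<lambda>h. \<Sum>k\<in>I. frechet_derivative (F k) (at x) h)) (at x)"
    using assms frechet_derivative_works by (intro has_derivative_sum) blast
  from partial_eq[OF this] show ?thesis by (simp add: partial_def)
qed

lemma partial_cmult:
  fixes F :: "real^'m \<Rightarrow> real"
  shows "F differentiable (at x) \<Longrightarrow> partial (\<lambda>x. c * F x) i x = c * partial F i x"
  by (simp add: partial_mult)

lemma smooth_on_cmult:
  fixes F :: "real^'m \<Rightarrow> real"
  shows "smooth_on W F \<Longrightarrow> smooth_on W (\<lambda>x. c * F x)"
  unfolding smooth_on_iff_diff_upto using diff_upto_mult diff_upto_const by blast

lemma smooth_on_sum:
  assumes "open W" "finite I" "\<And>k. k \<in> I \<Longrightarrow> smooth_on W (F k)"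
  shows "smooth_on W (\<lambda>x. \<Sum>k\<in>I. F k x)"
  using assms diff_upto_sum[OF assms(1,2)] unfolding smooth_on_iff_diff_upto by blast

lemma smooth_on_add:
  "smooth_on W F \<Longrightarrow> smooth_on W G \<Longrightarrow> smooth_on W (\<lambda>x. F x + G x)"
  unfolding smooth_on_iff_diff_upto using diff_upto_add by blast

lemma smooth_on_inner_const: "smooth_on W F \<Longrightarrow> smooth_on W (\<lambda>x. F x \<bullet> c)"
  unfolding smooth_on_iff_diff_upto using diff_upto_inner_const by blast

lemma smooth_on_nth:
  fixes F :: "real^'m \<Rightarrow> real^'k"
  shows "smooth_on W F \<Longrightarrow> smooth_on W (\<lambda>x. F x $ k)"
  using smooth_on_inner_const[of W F "axis k 1"] by (simp add: inner_axis)

lemma partial_partial_inner_const: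
  assumes "smooth_on W F" "x \<in> W"
  shows "partial (partial (\<lambda>x. F x \<bullet> c) j) i x = partial (partial F j) i x \<bullet> c"
proof -
  have W: "open W" using assms(1) by (simp add: smooth_on_def)
  have "partial (partial (\<lambda>x. F x \<bullet> c) j) i x = partial (\<lambda>x. partial F j x \<bullet> c) i x"
    by (rule partial_cong[OF W assms(2)]) (simp add: partial_inner_const smooth_on_differentiable[OF assms(1)])
  also have "\<dots> = partial (partial F j) i x \<bullet> c"
    by (rule partial_inner_const) (rule smooth_on_differentiable[OF smooth_on_partial[OF assms(1)] assms(2)])
  finally show ?thesis .
qed

section \<open>Restriction to lines: symmetry of second derivatives and the second derivative
  test\<close>

lemma has_real_derivative_along_line:
  fixes f :: "real^'m \<Rightarrow> real"
  assumes "f differentiable (at (x + t *\<^sub>R v))"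
  shows "((\<lambda>t. f (x + t *\<^sub>R v)) has_real_derivative (\<Sum>i\<in>UNIV. v $ i * partial f i (x + t *\<^sub>R v))) (at t)"
proof -
  have "((\<lambda>t. x + t *\<^sub>R v) has_derivative (\<lambda>s. s *\<^sub>R v)) (at t)"
    by (auto intro!: derivative_eq_intros)
  from has_derivative_compose[OF this has_derivative_sum_partial[OF assms]]
  have "((\<lambda>t. f (x + t *\<^sub>R v)) has_derivative
      (\<lambda>s. \<Sum>i\<in>UNIV. (s *\<^sub>R v) $ i *\<^sub>R partial f i (x + t *\<^sub>R v))) (at t)" .
  moreover have "(\<lambda>s. \<Sum>i\<in>UNIV. (s *\<^sub>R v) $ i *\<^sub>R partial f i (x + t *\<^sub>R v))
      = (*) (\<Sum>i\<in>UNIV. v $ i * partial f i (x + t *\<^sub>R v))"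
    by (simp add: fun_eq_iff sum_distrib_right) (simp add: mult_ac)
  ultimately show ?thesis by (simp add: has_field_derivative_def)
qed

lemma has_real_derivative_along_axis:
  fixes f :: "real^'m \<Rightarrow> real"
  assumes "f differentiable (at (x + t *\<^sub>R axis i 1))"
  shows "((\<lambda>t. f (x + t *\<^sub>R axis i 1)) has_real_derivative partial f i (x + t *\<^sub>R axis i 1)) (at t)"
  using has_real_derivative_along_line[OF assms]
  by (simp add: axis_def if_distrib[of "\<lambda>z. z * _"] sum.delta cong: if_cong)

text \<open>The mean value theorem is used twice: in direction i on the difference of
  \<open>f\<close> across a step in direction j, then in direction j on the resulting partial
  derivative.\<close>

lemma double_difference_mean_value:
  fixes f :: "real^'m \<Rightarrow> real"
  assumes "ball x r \<subseteq> W" "smooth_on W f" "0 < h" "2 * h < r"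
  obtains p where "dist x p < r"
    "f (x + h *\<^sub>R axis i 1 + h *\<^sub>R axis j 1) - f (x + h *\<^sub>R axis i 1) - f (x + h *\<^sub>R axis j 1) + f x
       = h * h * partial (partial f i) j p"
proof -
  let ?i = "axis i (1::real) :: real^'m" and ?j = "axis j (1::real) :: real^'m"
  have near: "dist x (x + s *\<^sub>R ?i + t *\<^sub>R ?j) \<le> 2 * h" if "0 \<le> s" "s \<le> h" "0 \<le> t" "t \<le> h" for s t
  proof -
    have "norm (s *\<^sub>R ?i + t *\<^sub>R ?j) \<le> norm (s *\<^sub>R ?i) + norm (t *\<^sub>R ?j)" by (rule norm_triangle_ineq)
    also have "\<dots> \<le> 2 * h" using that by simp
    finally have "norm (s *\<^sub>R ?i + t *\<^sub>R ?j) \<le> 2 * h" .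
    moreover have "x - (x + s *\<^sub>R ?i + t *\<^sub>R ?j) = - (s *\<^sub>R ?i + t *\<^sub>R ?j)" by simp
    ultimately show ?thesis unfolding dist_norm by (metis norm_minus_cancel)
  qed
  have inW: "x + s *\<^sub>R ?i + t *\<^sub>R ?j \<in> W" if "0 \<le> s" "s \<le> h" "0 \<le> t" "t \<le> h" for s t
    using near[OF that] assms by (auto simp: subset_iff)
  define q where "q s = f (x + h *\<^sub>R ?j + s *\<^sub>R ?i) - f (x + s *\<^sub>R ?i)" for s
  have "(q has_real_derivative (partial f i (x + h *\<^sub>R ?j + s *\<^sub>R ?i) - partial f i (x + s *\<^sub>R ?i))) (at s)"
    if "0 \<le> s" "s \<le> h" for s
    unfolding q_def using inW[of s h] inW[of s 0] that assms(2,3)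
    by (intro derivative_intros has_real_derivative_along_axis)
       (auto simp: add_ac intro: smooth_on_differentiable)
  from MVT2[OF assms(3), of q, OF this] obtain s where s: "0 < s" "s < h"
    "q h - q 0 = (h - 0) * (partial f i (x + h *\<^sub>R ?j + s *\<^sub>R ?i) - partial f i (x + s *\<^sub>R ?i))" by blast
  have "((\<lambda>t. partial f i (x + s *\<^sub>R ?i + t *\<^sub>R ?j)) has_real_derivative partial (partial f i) j (x + s *\<^sub>R ?i + t *\<^sub>R ?j)) (at t)"
    if "0 \<le> t" "t \<le> h" for t
    using inW[of s t] that s smooth_on_partial[OF assms(2)]
    by (intro has_real_derivative_along_axis) (auto intro: smooth_on_differentiable)
  from MVT2[OF assms(3) this] obtain t where t: "0 < t" "t < h"
    "partial f i (x + s *\<^sub>R ?i + h *\<^sub>R ?j) - partial f i (x + s *\<^sub>R ?i + 0 *\<^sub>R ?j) = (h - 0) * partial (partial f i) j (x + s *\<^sub>R ?i + t *\<^sub>R ?j)" by blast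
  show ?thesis
  proof (rule that[of "x + s *\<^sub>R ?i + t *\<^sub>R ?j"])
    show "dist x (x + s *\<^sub>R ?i + t *\<^sub>R ?j) < r" using near[of s t] s t assms(4) by simp
    show "f (x + h *\<^sub>R ?i + h *\<^sub>R ?j) - f (x + h *\<^sub>R ?i) - f (x + h *\<^sub>R ?j) + f x
       = h * h * partial (partial f i) j (x + s *\<^sub>R ?i + t *\<^sub>R ?j)"
      using s(3) t(3) by (simp add: q_def algebra_simps)
  qed
qed

text \<open>Schwarz's theorem: the second difference is symmetric in i and j, so the two mixed
  derivatives share a value at points as near to x as desired, and continuity forces them to
  agree.\<close>

lemma partial_commute:
  fixes f :: "real^'m \<Rightarrow> real"
  assumes "smooth_on W f" "x \<in> W"
  shows "partial (partial f j) i x = partial (partial f i) j x"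
proof (rule ccontr)
  let ?a = "partial (partial f j) i" and ?b = "partial (partial f i) j"
  assume ne: "?a x \<noteq> ?b x"
  \<comment> \<open>Half of the gap: values within e of the two limits cannot coincide.\<close>
  define e where "e = \<bar>?a x - ?b x\<bar> / 2"
  have e: "e > 0" using ne by (simp add: e_def)
  have W: "open W" using assms(1) by (simp add: smooth_on_def)
  have "continuous_on W ?a" "continuous_on W ?b"
    using assms(1) by (auto intro: smooth_on_continuous_on smooth_on_partial)
  then have "isCont ?a x" "isCont ?b x" using W assms(2) by (auto simp: continuous_on_eq_continuous_at)
  then obtain d1 d2 where d: "d1 > 0" "d2 > 0"
    "\<And>y. dist y x < d1 \<Longrightarrow> dist (?a y) (?a x) < e" "\<And>y. dist y x < d2 \<Longrightarrow> dist (?b y) (?b x) < e"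
    unfolding continuous_at_eps_delta using e by metis
  obtain r0 where r0: "r0 > 0" "ball x r0 \<subseteq> W" using W assms(2) openE by blast
  define r where "r = min r0 (min d1 d2)"
  have r: "r > 0" "ball x r \<subseteq> W" "r \<le> d1" "r \<le> d2" using r0 d(1,2) by (auto simp: r_def)
  have h: "0 < r / 4" "2 * (r / 4) < r" using r by auto
  obtain p where p: "dist x p < r"
    "f (x + (r/4) *\<^sub>R axis i 1 + (r/4) *\<^sub>R axis j 1) - f (x + (r/4) *\<^sub>R axis i 1) - f (x + (r/4) *\<^sub>R axis j 1) + f x
       = (r/4) * (r/4) * ?b p"
    using double_difference_mean_value[OF r(2) assms(1) h] by metis
  obtain q where q: "dist x q < r"
    "f (x + (r/4) *\<^sub>R axis j 1 + (r/4) *\<^sub>R axis i 1) - f (x + (r/4) *\<^sub>R axis j 1) - f (x + (r/4) *\<^sub>R axis i 1) + f x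
       = (r/4) * (r/4) * ?a q"
    using double_difference_mean_value[OF r(2) assms(1) h] by metis
  have "(r/4) * (r/4) * ?a q = (r/4) * (r/4) * ?b p"
    unfolding p(2)[symmetric] q(2)[symmetric] by (simp add: add_ac)
  then have "?a q = ?b p" using h(1) by simp
  moreover have "dist (?a q) (?a x) < e" "dist (?b p) (?b x) < e"
    using p q d(3)[of q] d(4)[of p] r by (auto simp: dist_commute)
  ultimately show False unfolding e_def dist_real_def by argo
qed

text \<open>On the line through x in direction v, a negative second derivative would make the first
  derivative, which is 0 at x, negative just beyond x, and the mean value theorem would produce a
  smaller value.\<close>

lemma local_min_partials:
  fixes f :: "real^'m \<Rightarrow> real"
  assumes "smooth_on W f" "x \<in> W" "\<And>y. y \<in> W \<Longrightarrow> f x \<le> f y"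
  shows "partial f i x = 0" "0 \<le> (\<Sum>i\<in>UNIV. \<Sum>j\<in>UNIV. v $ i * v $ j * partial (partial f i) j x)"
proof -
  have W: "open W" using assms(1) by (simp add: smooth_on_def)
  have sm: "smooth_on W (partial f i)" for i by (rule smooth_on_partial[OF assms(1)])
  have "frechet_derivative f (at x) = (\<lambda>v. 0)"
    by (rule differential_zero_maxmin[OF assms(2) W])
       (use assms smooth_on_differentiable frechet_derivative_works in blast)+
  then show z: "partial f i x = 0" for i by (simp add: partial_def)
  define g where "g t = (\<Sum>i\<in>UNIV. v $ i * partial f i (x + t *\<^sub>R v))" for t
  let ?T = "(\<lambda>t. x + t *\<^sub>R v) -` W"
  have "open ?T" by (intro open_vimage W continuous_intros)
  then obtain r where r: "r > 0" "ball 0 r \<subseteq> ?T" using assms(2) openE[of ?T 0] by auto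
  have d1: "((\<lambda>t. f (x + t *\<^sub>R v)) has_real_derivative g t) (at t)" if "t \<in> ?T" for t
    unfolding g_def using that smooth_on_differentiable[OF assms(1)] has_real_derivative_along_line by blast
  have d2: "(g has_real_derivative (\<Sum>i\<in>UNIV. v $ i * (\<Sum>j\<in>UNIV. v $ j * partial (partial f i) j (x + t *\<^sub>R v)))) (at t)" if "t \<in> ?T" for t
    unfolding g_def using that smooth_on_differentiable[OF sm]
    by (intro DERIV_sum DERIV_cmult has_real_derivative_along_line) auto
  have eq: "(\<Sum>i\<in>UNIV. \<Sum>j\<in>UNIV. v $ i * v $ j * partial (partial f i) j x)
     = (\<Sum>i\<in>UNIV. v $ i * (\<Sum>j\<in>UNIV. v $ j * partial (partial f i) j x))"
    by (simp add: sum_distrib_left mult.assoc)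
  show "0 \<le> (\<Sum>i\<in>UNIV. \<Sum>j\<in>UNIV. v $ i * v $ j * partial (partial f i) j x)"
  proof (rule ccontr)
    assume "\<not> ?thesis"
    then have neg: "(\<Sum>i\<in>UNIV. v $ i * (\<Sum>j\<in>UNIV. v $ j * partial (partial f i) j x)) < 0" by (simp add: eq)
    have der: "(g has_real_derivative (\<Sum>i\<in>UNIV. v $ i * (\<Sum>j\<in>UNIV. v $ j * partial (partial f i) j x))) (at 0)"
      using d2[of 0] assms(2) by simp
    obtain d where d: "d > 0" "\<And>h. 0 < h \<Longrightarrow> h < d \<Longrightarrow> g h < g 0"
      using DERIV_neg_dec_right[OF der neg] by auto
    have g0: "g 0 = 0" by (simp add: g_def z)
    define h where "h = min d r / 2"
    have h: "0 < h" "h < d" "h < r" using d r by (auto simp: h_def)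
    have inT: "t \<in> ?T" if "0 \<le> t" "t \<le> h" for t using r(2) that h by (auto simp: subset_iff)
    obtain s where s: "0 < s" "s < h" "f (x + h *\<^sub>R v) - f (x + 0 *\<^sub>R v) = (h - 0) * g s"
      using MVT2[OF h(1), of "\<lambda>t. f (x + t *\<^sub>R v)" g] d1 inT by blast
    have "g s < 0" using d(2)[of s] s h g0 by simp
    then have "f (x + h *\<^sub>R v) < f x" using s(3) h(1) mult_pos_neg[of h "g s"] by simp
    moreover have "f x \<le> f (x + h *\<^sub>R v)" using assms(3) inT[of h] h by simp
    ultimately show False by simp
  qed
qed

section \<open>Quadratic forms and the Hessian\<close>

definition grad :: "(real^'m \<Rightarrow> real) \<Rightarrow> real^'m \<Rightarrow> real^'m" where
  "grad f x = (\<chi> i. partial f i x)"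

definition hess :: "(real^'m \<Rightarrow> real) \<Rightarrow> real^'m \<Rightarrow> real^'m^'m" where
  "hess f x = (\<chi> i j. partial (partial f j) i x)"

lemma transpose_hess: "smooth_on W f \<Longrightarrow> x \<in> W \<Longrightarrow> transpose (hess f x) = hess f x"
  by (simp add: transpose_def hess_def vec_eq_iff partial_commute)

lemma inner_matrix_vector: "(v::real^'m) \<bullet> (M *v w) = (\<Sum>i\<in>UNIV. \<Sum>j\<in>UNIV. v $ i * w $ j * M $ i $ j)"
  by (simp add: inner_vec_def matrix_vector_mult_def sum_distrib_left mult_ac)

lemma inner_matrix_axis: "axis i (1::real) \<bullet> (M *v axis j 1) = M $ i $ j"
  by (simp add: matrix_vector_mult_basis column_def inner_axis' )

lemma inner_matrix_commute:
  fixes M :: "real^'m^'m"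
  assumes "transpose M = M"
  shows "v \<bullet> (M *v w) = w \<bullet> (M *v v)"
  by (metis assms dot_lmul_matrix inner_commute transpose_matrix_vector)

text \<open>With w = M e, the form at e + t w is 2 t |w|^2 + t^2 (w . M w); nonnegativity for small
  negative t rules out a nonzero linear term.\<close>

lemma psd_kernel:
  fixes M :: "real^'m^'m"
  assumes sym: "transpose M = M" and psd: "\<And>v. 0 \<le> v \<bullet> (M *v v)" and e: "e \<bullet> (M *v e) = 0"
  shows "M *v e = 0"
proof -
  define w where "w = M *v e"
  define a where "a = w \<bullet> (M *v w)"
  define b where "b = w \<bullet> w"
  have "0 \<le> a" by (simp add: a_def psd)
  \<comment> \<open>The minimiser would be - b / a; the added 1 covers a = 0.\<close>
  define t where "t = - b / (a + 1)"
  have "0 \<le> (e + t *\<^sub>R w) \<bullet> (M *v (e + t *\<^sub>R w))" by (rule psd)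
  also have "\<dots> = 2 * t * b + t * t * a"
    using e inner_matrix_commute[OF sym, of e w]
    by (simp add: matrix_vector_right_distrib matrix_vector_mult_scaleR inner_add_left inner_add_right
        a_def b_def w_def[symmetric] algebra_simps)
  finally have "0 \<le> (2 * t * b + t * t * a) * ((a + 1) * (a + 1))"
    using \<open>0 \<le> a\<close> by simp
  also have "\<dots> = 2 * b * (a + 1) * (t * (a + 1)) + a * (t * (a + 1)) * (t * (a + 1))"
    by (simp add: algebra_simps)
  also have "t * (a + 1) = - b" using \<open>0 \<le> a\<close> by (simp add: t_def)
  finally have "b * b * (a + 2) \<le> 0" by (simp add: algebra_simps)
  then have "b = 0" using \<open>0 \<le> a\<close> by (auto simp: mult_le_0_iff)
  then show ?thesis by (simp add: b_def w_def)
qed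

lemma det_eq_0_iff_kernel:
  fixes M :: "real^'m^'m"
  shows "det M = 0 \<longleftrightarrow> (\<exists>e. norm e = 1 \<and> M *v e = 0)"
proof -
  have "det M = 0 \<longleftrightarrow> (\<exists>x. x \<noteq> 0 \<and> M *v x = 0)"
    using invertible_det_nz[of M] invertible_left_inverse[of M] matrix_left_invertible_ker[of M] by metis
  also have "\<dots> \<longleftrightarrow> (\<exists>e. norm e = 1 \<and> M *v e = 0)"
  proof
    assume "\<exists>x. x \<noteq> 0 \<and> M *v x = 0"
    then obtain x where x: "x \<noteq> 0" "M *v x = 0" by blast
    then have "norm (x /\<^sub>R norm x) = 1" "M *v (x /\<^sub>R norm x) = 0"
      by (auto simp: matrix_vector_mult_scaleR)
    then show "\<exists>e. norm e = 1 \<and> M *v e = 0" by blast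
  next
    assume "\<exists>e. norm e = 1 \<and> M *v e = 0"
    then show "\<exists>x. x \<noteq> 0 \<and> M *v x = 0" by (metis norm_zero zero_neq_one)
  qed
  finally show ?thesis .
qed

text \<open>Lets a zero determinant stand for a vanishing smallest eigenvalue without introducing
  eigenvalues.\<close>

lemma det_eq_0_iff_psd:
  fixes M :: "real^'m^'m"
  assumes "transpose M = M" "\<And>v. 0 \<le> v \<bullet> (M *v v)"
  shows "det M = 0 \<longleftrightarrow> (\<exists>e. norm e = 1 \<and> e \<bullet> (M *v e) = 0)"
  using det_eq_0_iff_kernel[of M] psd_kernel[OF assms] by (metis inner_zero_right)

text \<open>Subtracting the minimum l times the identity leaves a positive semidefinite matrix whose
  form vanishes at e, so \<open>psd_kernel\<close> applies.\<close>

lemma min_quadratic_form_eigenvector: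
  fixes M :: "real^'m^'m"
  assumes sym: "transpose M = M" and e: "norm e = 1"
    and min: "\<And>v. norm v = 1 \<Longrightarrow> e \<bullet> (M *v e) \<le> v \<bullet> (M *v v)"
  shows "M *v e = (e \<bullet> (M *v e)) *\<^sub>R e"
proof -
  define l where "l = e \<bullet> (M *v e)"
  define N where "N = M - l *\<^sub>R mat 1"
  have N: "N *v v = M *v v - l *\<^sub>R v" for v
    by (simp add: N_def matrix_vector_mult_diff_rdistrib scaleR_matrix_vector_assoc[symmetric])
  have "transpose N = N"
    using sym by (simp add: N_def transpose_def vec_eq_iff mat_def)
  moreover have "0 \<le> v \<bullet> (N *v v)" for v
  proof (cases "v = 0")
    case False
    have "l \<le> (v /\<^sub>R norm v) \<bullet> (M *v (v /\<^sub>R norm v))"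
      unfolding l_def using False by (intro min) simp
    also have "\<dots> = (v \<bullet> (M *v v)) / (norm v)\<^sup>2"
      by (simp add: matrix_vector_mult_scaleR power2_eq_square field_simps)
    finally have "l * (norm v)\<^sup>2 \<le> v \<bullet> (M *v v)"
      using False by (simp add: field_simps)
    then show ?thesis by (simp add: N inner_diff_right power2_norm_eq_inner)
  qed simp
  moreover have "e \<bullet> (N *v e) = 0"
    using e by (simp add: N inner_diff_right l_def[symmetric] power2_norm_eq_inner[symmetric])
  ultimately have "N *v e = 0" by (rule psd_kernel)
  then show ?thesis by (simp add: N l_def)
qed

text \<open>Up to the factor \<open>1 + p \<bullet> p\<close>, this is the trace of \<open>N\<close> with respect to the metric
  \<open>I + p p\<^sup>T\<close> of a graph with gradient \<open>p\<close>.\<close>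
definition graph_trace :: "real^'m \<Rightarrow> real^'m^'m \<Rightarrow> real" where
  "graph_trace p N = (1 + p \<bullet> p) * trace N - p \<bullet> (N *v p)"

text \<open>Lagrange's identity: the form summed over the vectors p_i e_j - p_j e_i for all ordered
  pairs is twice |p|^2 trace N - p . N p, and what is left of \<open>graph_trace\<close> is trace N.
  This is the ellipticity of the graph equation.\<close>

lemma graph_trace_nonneg:
  fixes N :: "real^'m^'m"
  assumes psd: "\<And>v. 0 \<le> v \<bullet> (N *v v)"
  shows "0 \<le> graph_trace p N"
proof -
  have "0 \<le> axis i 1 \<bullet> (N *v axis i 1)" for i by (rule psd)
  then have tr: "0 \<le> trace N"
    by (auto simp: trace_def inner_matrix_axis intro: sum_nonneg)
  have "0 \<le> (p $ i *\<^sub>R axis j 1 - p $ j *\<^sub>R axis i 1) \<bullet> (N *v (p $ i *\<^sub>R axis j 1 - p $ j *\<^sub>R axis i 1))" for i j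
    by (rule psd)
  also have "(p $ i *\<^sub>R axis j 1 - p $ j *\<^sub>R axis i 1) \<bullet> (N *v (p $ i *\<^sub>R axis j 1 - p $ j *\<^sub>R axis i 1))
     = (p $ i * p $ i) * N $ j $ j - p $ i * p $ j * N $ j $ i - p $ j * p $ i * N $ i $ j + (p $ j * p $ j) * N $ i $ i" for i j
    by (simp add: matrix_vector_mult_diff_distrib matrix_vector_mult_scaleR inner_diff_left inner_diff_right
        inner_matrix_axis algebra_simps)
  finally have *: "0 \<le> (p $ i * p $ i) * N $ j $ j - p $ i * p $ j * N $ j $ i - p $ j * p $ i * N $ i $ j + (p $ j * p $ j) * N $ i $ i" for i j .
  have "0 \<le> (\<Sum>i\<in>UNIV. \<Sum>j\<in>UNIV. (p $ i * p $ i) * N $ j $ j - p $ i * p $ j * N $ j $ i - p $ j * p $ i * N $ i $ j + (p $ j * p $ j) * N $ i $ i)"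
    by (intro sum_nonneg *)
  also have "\<dots> = (\<Sum>i\<in>UNIV. \<Sum>j\<in>UNIV. (p $ i * p $ i) * N $ j $ j) - (\<Sum>i\<in>UNIV. \<Sum>j\<in>UNIV. p $ i * p $ j * N $ j $ i)
      - (\<Sum>i\<in>UNIV. \<Sum>j\<in>UNIV. p $ j * p $ i * N $ i $ j) + (\<Sum>i\<in>UNIV. \<Sum>j\<in>UNIV. (p $ j * p $ j) * N $ i $ i)"
    by (simp add: sum.distrib sum_subtractf)
  also have "(\<Sum>i\<in>UNIV. \<Sum>j\<in>UNIV. (p $ i * p $ i) * N $ j $ j) = (p \<bullet> p) * trace N"
    by (simp add: inner_vec_def trace_def sum_product)
  also have "(\<Sum>i\<in>UNIV. \<Sum>j\<in>UNIV. (p $ j * p $ j) * N $ i $ i) = (p \<bullet> p) * trace N"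
    by (subst sum.swap) (simp add: inner_vec_def trace_def sum_product)
  also have "(\<Sum>i\<in>UNIV. \<Sum>j\<in>UNIV. p $ i * p $ j * N $ j $ i) = p \<bullet> (N *v p)"
    by (subst sum.swap) (simp add: inner_matrix_vector mult_ac)
  also have "(\<Sum>i\<in>UNIV. \<Sum>j\<in>UNIV. p $ j * p $ i * N $ i $ j) = p \<bullet> (N *v p)"
    by (simp add: inner_matrix_vector mult_ac)
  finally show ?thesis using tr by (simp add: graph_trace_def algebra_simps)
qed

lemma graph_trace_diff: "graph_trace p (M - N) = graph_trace p M - graph_trace p N"
  by (simp add: graph_trace_def trace_sub matrix_vector_mult_diff_rdistrib inner_diff_right algebra_simps)

section \<open>First and second derivatives of curves\<close>

definition jet2 :: "real set \<Rightarrow> (real \<Rightarrow> 'a::real_normed_vector) \<Rightarrow> (real \<Rightarrow> 'a) \<Rightarrow> (real \<Rightarrow> 'a) \<Rightarrow> bool" where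
  "jet2 S f f1 f2 \<longleftrightarrow> (\<forall>t\<in>S. (f has_vector_derivative f1 t) (at t) \<and> (f1 has_vector_derivative f2 t) (at t))"

text \<open>The Leibniz rule to second order for an arbitrary product: inner, scalar and
  matrix-vector products can be nested, and the second derivative of the composite is assembled as
  an explicit term.\<close>

lemma jet2_bilinear:
  assumes "bounded_bilinear B" "jet2 S f f1 f2" "jet2 S g g1 g2"
  shows "jet2 S (\<lambda>t. B (f t) (g t)) (\<lambda>t. B (f t) (g1 t) + B (f1 t) (g t))
    (\<lambda>t. B (f t) (g2 t) + 2 *\<^sub>R B (f1 t) (g1 t) + B (f2 t) (g t))"
  unfolding jet2_def
proof (intro ballI conjI)
  fix t assume t: "t \<in> S"
  have D: "(f has_vector_derivative f1 t) (at t)" "(f1 has_vector_derivative f2 t) (at t)"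
    "(g has_vector_derivative g1 t) (at t)" "(g1 has_vector_derivative g2 t) (at t)"
    using assms(2,3) t by (auto simp: jet2_def)
  note bil = bounded_bilinear.has_vector_derivative[OF assms(1)]
  show "((\<lambda>t. B (f t) (g t)) has_vector_derivative B (f t) (g1 t) + B (f1 t) (g t)) (at t)"
    by (rule bil[OF D(1,3)])
  have "((\<lambda>t. B (f t) (g1 t) + B (f1 t) (g t)) has_vector_derivative
     (B (f t) (g2 t) + B (f1 t) (g1 t)) + (B (f1 t) (g1 t) + B (f2 t) (g t))) (at t)"
    by (rule has_vector_derivative_add[OF bil[OF D(1,4)] bil[OF D(2,3)]])
  then show "((\<lambda>t. B (f t) (g1 t) + B (f1 t) (g t)) has_vector_derivative
     B (f t) (g2 t) + 2 *\<^sub>R B (f1 t) (g1 t) + B (f2 t) (g t)) (at t)"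
    by (simp add: scaleR_2 add.assoc)
qed

lemma jet2_linear:
  assumes "bounded_linear L" "jet2 S f f1 f2"
  shows "jet2 S (\<lambda>t. L (f t)) (\<lambda>t. L (f1 t)) (\<lambda>t. L (f2 t))"
  using assms(2) bounded_linear.has_vector_derivative[OF assms(1)] unfolding jet2_def by blast

lemma jet2_add:
  "jet2 S f f1 f2 \<Longrightarrow> jet2 S g g1 g2 \<Longrightarrow> jet2 S (\<lambda>t. f t + g t) (\<lambda>t. f1 t + g1 t) (\<lambda>t. f2 t + g2 t)"
  unfolding jet2_def by (auto intro: has_vector_derivative_add)

lemma jet2_diff:
  "jet2 S f f1 f2 \<Longrightarrow> jet2 S g g1 g2 \<Longrightarrow> jet2 S (\<lambda>t. f t - g t) (\<lambda>t. f1 t - g1 t) (\<lambda>t. f2 t - g2 t)"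
  unfolding jet2_def by (auto intro: has_vector_derivative_diff)

lemma jet2_const: "jet2 S (\<lambda>t. c) (\<lambda>t. 0) (\<lambda>t. 0)"
  unfolding jet2_def by auto

lemma jet2_zero:
  assumes "open S" "jet2 S f f1 f2" "\<And>t. t \<in> S \<Longrightarrow> f t = 0" "t \<in> S"
  shows "f2 t = 0"
proof -
  have z: "g' = 0" if "(g has_vector_derivative g') (at t)" "\<And>t. t \<in> S \<Longrightarrow> g t = 0" "t \<in> S"
    for g g' and t :: real
  proof -
    have "((\<lambda>t. 0) has_vector_derivative g') (at t)"
      by (rule has_vector_derivative_transform_within_open[OF that(1) assms(1) that(3) that(2)])
    then show ?thesis
      using vector_derivative_unique_at has_vector_derivative_const by blast
  qed
  have "f1 t = 0" if "t \<in> S" for t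
    using z[of f "f1 t" t] that assms(2,3) by (auto simp: jet2_def)
  then show ?thesis using z[of f1 "f2 t" t] assms(2,4) by (auto simp: jet2_def)
qed

lemma has_vector_derivative_vec:
  fixes f :: "real \<Rightarrow> 'b::euclidean_space^'n"
  assumes "\<And>i. ((\<lambda>t. f t $ i) has_vector_derivative f' $ i) (at t)"
  shows "(f has_vector_derivative f') (at t)"
  unfolding has_vector_derivative_def
proof (subst has_derivative_componentwise_within, intro ballI)
  fix b :: "'b^'n" assume "b \<in> Basis"
  then obtain i c where b: "b = axis i c" "c \<in> Basis" by (auto simp: Basis_vec_def)
  have "((\<lambda>t. f t $ i \<bullet> c) has_derivative (\<lambda>s. (s *\<^sub>R f' $ i) \<bullet> c)) (at t)"
    using assms[of i] unfolding has_vector_derivative_def by (rule has_derivative_inner_left)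
  then show "((\<lambda>x. f x \<bullet> b) has_derivative (\<lambda>x. (x *\<^sub>R f') \<bullet> b)) (at t)"
    by (simp add: b inner_axis)
qed

lemma jet2_vec:
  fixes f :: "real \<Rightarrow> 'b::euclidean_space^'n"
  assumes "\<And>i. jet2 S (\<lambda>t. f t $ i) (\<lambda>t. f1 t $ i) (\<lambda>t. f2 t $ i)"
  shows "jet2 S f f1 f2"
  using assms has_vector_derivative_vec unfolding jet2_def by metis

lemma jet2_along_line:
  fixes f :: "real^'m \<Rightarrow> real"
  assumes "smooth_on W f" "S = {t. x + t *\<^sub>R v \<in> W}"
  shows "jet2 S (\<lambda>t. f (x + t *\<^sub>R v)) (\<lambda>t. v \<bullet> grad f (x + t *\<^sub>R v)) (\<lambda>t. v \<bullet> (hess f (x + t *\<^sub>R v) *v v))"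
  unfolding jet2_def has_real_derivative_iff_has_vector_derivative[symmetric]
proof (intro ballI conjI)
  fix t assume "t \<in> S"
  then have t: "x + t *\<^sub>R v \<in> W" using assms(2) by simp
  show "((\<lambda>t. f (x + t *\<^sub>R v)) has_real_derivative v \<bullet> grad f (x + t *\<^sub>R v)) (at t)"
    using has_real_derivative_along_line[OF smooth_on_differentiable[OF assms(1) t]]
    by (simp add: grad_def inner_vec_def)
  have "((\<lambda>t. \<Sum>i\<in>UNIV. v $ i * partial f i (x + t *\<^sub>R v)) has_real_derivative
     (\<Sum>i\<in>UNIV. v $ i * (\<Sum>j\<in>UNIV. v $ j * partial (partial f i) j (x + t *\<^sub>R v)))) (at t)"
    by (intro DERIV_sum DERIV_cmult has_real_derivative_along_line
        smooth_on_differentiable[OF smooth_on_partial[OF assms(1)] t])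
  moreover have "(\<Sum>i\<in>UNIV. v $ i * (\<Sum>j\<in>UNIV. v $ j * partial (partial f i) j (x + t *\<^sub>R v)))
     = v \<bullet> (hess f (x + t *\<^sub>R v) *v v)"
    unfolding inner_matrix_vector sum_distrib_left
    by (subst sum.swap) (simp add: hess_def mult_ac)
  ultimately show "((\<lambda>t. v \<bullet> grad f (x + t *\<^sub>R v)) has_real_derivative v \<bullet> (hess f (x + t *\<^sub>R v) *v v)) (at t)"
    by (simp add: grad_def inner_vec_def)
qed

section \<open>The soliton equation differentiated twice\<close>

lemma smooth_on_second_derivative:
  fixes u :: "real^'m \<Rightarrow> real"
  assumes "smooth_on W u"
  shows "smooth_on W (\<lambda>y. e \<bullet> (hess u y *v e))"
  unfolding inner_matrix_vector hess_def using assms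
  by (simp, intro smooth_on_sum smooth_on_cmult smooth_on_partial) (auto simp: smooth_on_def)

text \<open>Moves the outer derivative to the innermost place: the result is the second derivative
  of \<open>partial u i\<close> along e, as \<open>jet2_along_line\<close> produces it for the
  components of \<open>grad u\<close>.\<close>

lemma partial_second_derivative:
  fixes u :: "real^'m \<Rightarrow> real"
  assumes "smooth_on W u" "x \<in> W"
  shows "partial (\<lambda>y. e \<bullet> (hess u y *v e)) i x = e \<bullet> (hess (partial u i) x *v e)"
proof -
  have W: "open W" using assms(1) by (simp add: smooth_on_def)
  have sm: "smooth_on W (partial (partial u l) k)" for k l
    using assms(1) smooth_on_partial by blast
  have "partial (\<lambda>y. e \<bullet> (hess u y *v e)) i x =
      partial (\<lambda>y. \<Sum>k\<in>UNIV. \<Sum>l\<in>UNIV. (e $ k * e $ l) * partial (partial u l) k y) i x"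
    by (simp add: inner_matrix_vector hess_def)
  also have "\<dots> = (\<Sum>k\<in>UNIV. \<Sum>l\<in>UNIV. (e $ k * e $ l) * partial (partial (partial u l) k) i x)"
    using smooth_on_differentiable[OF sm assms(2)]
    by (simp add: partial_sum partial_cmult)
  also have "\<dots> = (\<Sum>k\<in>UNIV. \<Sum>l\<in>UNIV. (e $ k * e $ l) * partial (partial (partial u i) l) k x)"
  proof (intro sum.cong refl arg_cong2[where f="(*)"])
    fix k l
    have "partial (partial (partial u l) k) i x = partial (partial (partial u l) i) k x"
      by (rule partial_commute[OF smooth_on_partial[OF assms(1)] assms(2)])
    also have "\<dots> = partial (partial (partial u i) l) k x"
      by (rule partial_cong[OF W assms(2) partial_commute[OF assms(1)]])
    finally show "partial (partial (partial u l) k) i x = partial (partial (partial u i) l) k x" .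
  qed
  finally show ?thesis by (simp add: inner_matrix_vector hess_def)
qed

lemma grad_second_derivative:
  fixes u :: "real^'m \<Rightarrow> real"
  assumes "smooth_on W u" "x \<in> W"
  shows "grad (\<lambda>y. e \<bullet> (hess u y *v e)) x $ i = e \<bullet> (hess (partial u i) x *v e)"
  by (simp add: grad_def partial_second_derivative[OF assms])

lemma hess_second_derivative:
  fixes u :: "real^'m \<Rightarrow> real"
  assumes "smooth_on W u" "x \<in> W"
  shows "hess (\<lambda>y. e \<bullet> (hess u y *v e)) x $ i $ j = e \<bullet> (hess (partial (partial u j) i) x *v e)"
proof -
  have W: "open W" using assms(1) by (simp add: smooth_on_def)
  have "hess (\<lambda>y. e \<bullet> (hess u y *v e)) x $ i $ j = partial (\<lambda>y. e \<bullet> (hess (partial u j) y *v e)) i x"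
    unfolding hess_def[of "\<lambda>y. e \<bullet> (hess u y *v e)"]
    by (simp, rule partial_cong[OF W assms(2)]) (simp add: partial_second_derivative[OF assms(1)])
  also have "\<dots> = e \<bullet> (hess (partial (partial u j) i) x *v e)"
    by (rule partial_second_derivative[OF smooth_on_partial[OF assms(1)] assms(2)])
  finally show ?thesis .
qed

lemma bounded_bilinear_matrix_vector_mult: "bounded_bilinear ((*v) :: real^'m^'n \<Rightarrow> real^'m \<Rightarrow> real^'n)"
  unfolding bilinear_conv_bounded_bilinear[symmetric] bilinear_def
  by (auto intro!: linearI simp: matrix_vector_right_distrib matrix_vector_mult_scaleR
      matrix_vector_mult_add_rdistrib scaleR_matrix_vector_assoc)

lemma bounded_linear_trace: "bounded_linear (trace :: real^'m^'m \<Rightarrow> real)"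
  unfolding linear_conv_bounded_linear[symmetric]
  by (auto intro!: linearI simp: trace_def sum.distrib sum_distrib_left)

text \<open>Drift and remainder are read off from differentiating the equation
  \<open>graph_trace (grad u) (hess u) = (1 + |grad u|^2) (c0 + c \<bullet> grad u)\<close> twice in a direction \<open>e\<close>
  that is an eigenvector of the Hessian at the point considered: every term of the result that
  does not contain a derivative of \<open>w = e \<bullet> hess u e\<close> then carries the eigenvalue as a factor.\<close>

definition dhess :: "(real^'m \<Rightarrow> real) \<Rightarrow> real^'m \<Rightarrow> real^'m \<Rightarrow> real^'m^'m" where
  "dhess u e x = (\<chi> i j. e \<bullet> grad (partial (partial u j) i) x)"

definition soliton_drift :: "real \<Rightarrow> real^'m \<Rightarrow> (real^'m \<Rightarrow> real) \<Rightarrow> real^'m \<Rightarrow> real^'m" where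
  "soliton_drift c0 c u x = (2 * (trace (hess u x) - (c0 + c \<bullet> grad u x))) *\<^sub>R grad u x
     - 2 *\<^sub>R (hess u x *v grad u x) - (1 + grad u x \<bullet> grad u x) *\<^sub>R c"

definition soliton_remainder :: "real \<Rightarrow> real^'m \<Rightarrow> (real^'m \<Rightarrow> real) \<Rightarrow> real^'m \<Rightarrow> real^'m \<Rightarrow> real" where
  "soliton_remainder c0 c u x e =
     2 * (e \<bullet> (hess u x *v e)) * (trace (hess u x) - (c0 + c \<bullet> grad u x))
     + 4 * (grad u x \<bullet> e) * (trace (dhess u e x) - (e \<bullet> (hess u x *v e)) * (c \<bullet> e))
     - 2 * (e \<bullet> (dhess u e x *v grad u x)) - 2 * (grad u x \<bullet> (dhess u e x *v e))
     - 2 * (e \<bullet> (hess u x *v e)) * (e \<bullet> (hess u x *v e))"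

text \<open>On the line x + t e the difference of the two sides vanishes for all t near 0, and its
  second derivative at t = 0 is read off. As e is constant, \<open>grad u\<close> and
  \<open>hess u\<close> have the second derivatives \<open>grad w\<close> and \<open>hess w\<close>
  there, while the eigenvector hypothesis makes the first derivative of \<open>grad u\<close> equal
  to l e.\<close>

lemma soliton_equation_second_derivative:
  fixes u :: "real^'m \<Rightarrow> real"
  assumes u: "smooth_on W u" and x: "x \<in> W"
    and eqn: "\<And>y. y \<in> W \<Longrightarrow> graph_trace (grad u y) (hess u y)
        = (1 + grad u y \<bullet> grad u y) * (c0 + c \<bullet> grad u y)"
    and e: "norm e = 1" "hess u x *v e = (e \<bullet> (hess u x *v e)) *\<^sub>R e"
  defines "w \<equiv> \<lambda>y. e \<bullet> (hess u y *v e)"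
  shows "graph_trace (grad u x) (hess w x) + soliton_drift c0 c u x \<bullet> grad w x
     + w x * soliton_remainder c0 c u x e = 0"
proof -
  define S where "S = {t. x + t *\<^sub>R e \<in> W}"
  have W: "open W" using u by (simp add: smooth_on_def)
  have "open ((\<lambda>t. x + t *\<^sub>R e) -` W)" by (intro open_vimage W continuous_intros)
  then have S: "open S" "0 \<in> S" using x by (auto simp: S_def vimage_def)
  define P where "P t = grad u (x + t *\<^sub>R e)" for t
  define P1 where "P1 t = (\<chi> i. e \<bullet> grad (partial u i) (x + t *\<^sub>R e))" for t
  define P2 where "P2 t = (\<chi> i. e \<bullet> (hess (partial u i) (x + t *\<^sub>R e) *v e))" for t
  define U where "U t = hess u (x + t *\<^sub>R e)" for t
  define U1 where "U1 t = dhess u e (x + t *\<^sub>R e)" for t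
  define U2 where "U2 t = (\<chi> i j. e \<bullet> (hess (partial (partial u j) i) (x + t *\<^sub>R e) *v e))" for t
  have JP: "jet2 S P P1 P2"
    by (rule jet2_vec) (simp add: P_def P1_def P2_def grad_def[of u]
        jet2_along_line[OF smooth_on_partial[OF u] S_def])
  have JU: "jet2 S U U1 U2"
    by (intro jet2_vec) (simp add: U_def U1_def U2_def dhess_def hess_def[of u]
        jet2_along_line[OF smooth_on_partial[OF smooth_on_partial[OF u]] S_def])
  \<comment> \<open>The right-hand side is put under the factor 1 + |P|^2 that it shares with the
    trace, which leaves one product and one quadratic form to differentiate.\<close>
  have Jtr: "jet2 S (\<lambda>t. trace (U t) - (c0 + c \<bullet> P t)) (\<lambda>t. trace (U1 t) - (0 + c \<bullet> P1 t)) (\<lambda>t. trace (U2 t) - (0 + c \<bullet> P2 t))"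
    by (intro jet2_diff jet2_add jet2_const jet2_linear[OF bounded_linear_trace JU]
        jet2_linear[OF bounded_linear_inner_right JP])
  note Js = jet2_add[OF jet2_const[of S "1::real"] jet2_bilinear[OF bounded_bilinear_inner JP JP]]
  note JQ = jet2_diff[OF jet2_bilinear[OF bounded_bilinear_mult Js Jtr]
      jet2_bilinear[OF bounded_bilinear_inner JP jet2_bilinear[OF bounded_bilinear_matrix_vector_mult JU JP]]]
  have zero: "(1 + P t \<bullet> P t) * (trace (U t) - (c0 + c \<bullet> P t)) - P t \<bullet> (U t *v P t) = 0" if "t \<in> S" for t
    using eqn[of "x + t *\<^sub>R e"] that by (simp add: S_def P_def U_def graph_trace_def algebra_simps)
  define l where "l = w x"
  have sym: "transpose (hess u x) = hess u x" by (rule transpose_hess[OF u x])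
  have p: "P 0 = grad u x" and h: "U 0 = hess u x" and h1: "U1 0 = dhess u e x"
    by (auto simp: P_def U_def U1_def)
  have p1: "P1 0 = l *\<^sub>R e"
  proof -
    have "P1 0 = transpose (hess u x) *v e"
      by (simp add: P1_def vec_eq_iff inner_vec_def grad_def hess_def transpose_def
          matrix_vector_mult_def mult.commute)
    then show ?thesis using e(2) by (simp add: sym l_def w_def)
  qed
  have p2: "P2 0 = grad w x" and h2: "U2 0 = hess w x"
    by (simp_all add: P2_def U2_def vec_eq_iff w_def grad_second_derivative[OF u x] hess_second_derivative[OF u x])
  have he: "hess u x *v e = l *\<^sub>R e" "e \<bullet> (hess u x *v e) = l" using e(2) by (simp_all add: l_def w_def)
  have ee: "e \<bullet> e = 1" using e(1) by (simp add: norm_eq_1)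
  have com: "grad u x \<bullet> (hess u x *v grad w x) = grad w x \<bullet> (hess u x *v grad u x)"
    by (rule inner_matrix_commute[OF sym])
  show ?thesis
    using jet2_zero[OF S(1) JQ zero S(2)]
    unfolding p h h1 p1 p2 h2 soliton_drift_def soliton_remainder_def graph_trace_def he(2) l_def[symmetric]
    by (simp add: matrix_vector_mult_scaleR matrix_vector_right_distrib he ee com inner_diff_left inner_diff_right
        inner_add_left inner_add_right inner_commute[of "grad w x" "grad u x"] inner_commute[of e "grad u x"]
        inner_commute[of "hess u x *v grad u x" "grad w x"] algebra_simps)
qed

section \<open>The strong maximum principle for the smallest eigenvalue\<close>

definition gauss_bump :: "real \<Rightarrow> real^'m \<Rightarrow> real^'m \<Rightarrow> real" where
  "gauss_bump a c x = exp (- (a * ((x - c) \<bullet> (x - c))))"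

lemma has_derivative_gauss_bump:
  "(gauss_bump a c has_derivative (\<lambda>h. - (2 * a * ((x - c) \<bullet> h)) * gauss_bump a c x)) (at x)"
  unfolding gauss_bump_def[abs_def]
  by (auto intro!: derivative_eq_intros simp: inner_commute algebra_simps)

lemma partial_gauss_bump: "partial (gauss_bump a c) i x = - (2 * a) * (x $ i - c $ i) * gauss_bump a c x"
  using partial_eq[OF has_derivative_gauss_bump] by (simp add: inner_axis)

lemma has_derivative_coordinate: "((\<lambda>x::real^'m. x $ i - c) has_derivative (\<lambda>h. h $ i)) (at x)"
  using bounded_linear.has_derivative[OF bounded_linear_vec_nth has_derivative_ident]
  by (auto intro!: derivative_eq_intros)

lemma partial_coordinate: "partial (\<lambda>x::real^'m. x $ i - c) j x = (if i = j then 1 else 0)"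
  by (subst partial_eq[OF has_derivative_coordinate]) (simp add: axis_def)

lemma diff_upto_coordinate: "diff_upto n W (\<lambda>x::real^'m. x $ i - c)"
proof -
  have "partial (\<lambda>x::real^'m. x $ i - c) j = (\<lambda>x. if i = j then 1 else 0)" for j
    using partial_coordinate by blast
  moreover have "(\<lambda>x::real^'m. x $ i - c) differentiable (at x)" for x
    using has_derivative_coordinate differentiable_def by blast
  ultimately show ?thesis by (cases n) (auto simp: diff_upto_const)
qed

lemma smooth_on_gauss_bump: "smooth_on UNIV (gauss_bump a (c::real^'m))"
proof -
  have d: "gauss_bump a c differentiable (at x)" for x :: "real^'m"
    using has_derivative_gauss_bump differentiable_def by blast
  have "diff_upto n UNIV (gauss_bump a c)" for n
  proof (induction n)
    case 0 then show ?case using d by simp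
  next
    case (Suc n)
    have "diff_upto n UNIV (\<lambda>x::real^'m. - (2 * a) * (x $ i - c $ i) * gauss_bump a c x)" for i
      by (intro diff_upto_mult diff_upto_const diff_upto_coordinate Suc open_UNIV)
    moreover have "partial (gauss_bump a c) i = (\<lambda>x. - (2 * a) * (x $ i - c $ i) * gauss_bump a c x)" for i
      by (rule ext) (rule partial_gauss_bump)
    ultimately show ?case using d by simp
  qed
  then show ?thesis by (simp add: smooth_on_iff_diff_upto)
qed

lemma grad_gauss_bump: "grad (gauss_bump a c) x = (- 2 * a * gauss_bump a c x) *\<^sub>R (x - c)"
  by (simp add: grad_def vec_eq_iff partial_gauss_bump)

lemma hess_gauss_bump:
  "hess (gauss_bump a c) x $ i $ j = gauss_bump a c x *
    (4 * a\<^sup>2 * ((x - c) $ i * (x - c) $ j) - 2 * a * (if i = j then 1 else 0))"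
proof -
  have "partial (gauss_bump a c) j = (\<lambda>x. - (2 * a) * ((x $ j - c $ j) * gauss_bump a c x))"
    by (rule ext) (simp add: partial_gauss_bump)
  then have "hess (gauss_bump a c) x $ i $ j
      = partial (\<lambda>x. - (2 * a) * ((x $ j - c $ j) * gauss_bump a c x)) i x"
    by (simp add: hess_def)
  moreover have "(\<lambda>x::real^'a. x $ j - c $ j) differentiable (at x)"
    using has_derivative_coordinate differentiable_def by blast
  moreover have "gauss_bump a c differentiable (at x)"
    using has_derivative_gauss_bump differentiable_def by blast
  ultimately have "hess (gauss_bump a c) x $ i $ j = - (2 * a) *
      ((if j = i then 1 else 0) * gauss_bump a c x
        + (x $ j - c $ j) * (- (2 * a) * (x $ i - c $ i) * gauss_bump a c x))"
    by (subst (asm) partial_cmult)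
       (auto simp: partial_mult partial_coordinate partial_gauss_bump intro: differentiable_mult)
  then show ?thesis by (cases "i = j") (simp_all add: algebra_simps power2_eq_square)
qed

text \<open>For large a the a^2 term wins: by Cauchy-Schwarz its coefficient is at least 4 |x -
  c|^2, hence bounded below away from the centre c, whatever p is.\<close>

lemma graph_trace_hess_gauss_bump:
  fixes p c x :: "real^'m"
  shows "graph_trace p (hess (gauss_bump a c) x) = gauss_bump a c x *
     (4 * a\<^sup>2 * ((1 + p \<bullet> p) * ((x - c) \<bullet> (x - c)) - (p \<bullet> (x - c))\<^sup>2)
      - 2 * a * ((1 + p \<bullet> p) * CARD('m) - p \<bullet> p))"
proof -
  define d where "d = x - c"
  define G where "G = gauss_bump a c x"
  have H: "hess (gauss_bump a c) x $ i $ j = G * 4 * a\<^sup>2 * (d $ i * d $ j) - (if i = j then G * 2 * a else 0)" for i j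
    by (simp add: hess_gauss_bump d_def G_def algebra_simps)
  have tr: "trace (hess (gauss_bump a c) x) = G * 4 * a\<^sup>2 * (d \<bullet> d) - CARD('m) * (G * 2 * a)"
    by (simp add: trace_def H sum_subtractf inner_vec_def sum_distrib_left)
  have "hess (gauss_bump a c) x *v p = (G * 4 * a\<^sup>2 * (p \<bullet> d)) *\<^sub>R d - (G * 2 * a) *\<^sub>R p"
  proof -
    have "(hess (gauss_bump a c) x *v p) $ i = ((G * 4 * a\<^sup>2 * (p \<bullet> d)) *\<^sub>R d - (G * 2 * a) *\<^sub>R p) $ i" for i
    proof -
      have "(hess (gauss_bump a c) x *v p) $ i = (\<Sum>j\<in>UNIV. G * 4 * a\<^sup>2 * (d $ i * d $ j) * p $ j - (if i = j then G * 2 * a * p $ j else 0))"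
        by (simp add: matrix_vector_mult_def H left_diff_distrib if_distrib[of "\<lambda>z. z * _"] cong: if_cong)
      also have "\<dots> = (\<Sum>j\<in>UNIV. G * 4 * a\<^sup>2 * (d $ i * d $ j) * p $ j) - G * 2 * a * p $ i"
        by (simp add: sum_subtractf)
      also have "(\<Sum>j\<in>UNIV. G * 4 * a\<^sup>2 * (d $ i * d $ j) * p $ j) = G * 4 * a\<^sup>2 * (p \<bullet> d) * d $ i"
        by (simp add: inner_vec_def sum_distrib_left sum_distrib_right mult_ac)
      finally show ?thesis by simp
    qed
    then show ?thesis by (simp only: vec_eq_iff) blast
  qed
  then have "p \<bullet> (hess (gauss_bump a c) x *v p) = G * 4 * a\<^sup>2 * (p \<bullet> d) * (p \<bullet> d) - G * 2 * a * (p \<bullet> p)"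
    by (simp add: inner_diff_right)
  then show ?thesis
    by (simp add: graph_trace_def tr d_def[symmetric] G_def[symmetric] inner_diff_right power2_eq_square algebra_simps)
qed

lemma grad_hess_linear_combination:
  fixes F G :: "real^'m \<Rightarrow> real"
  assumes "smooth_on W F" "smooth_on W G" "x \<in> W"
  shows "grad (\<lambda>x. F x + k * G x) x = grad F x + k *\<^sub>R grad G x"
    "hess (\<lambda>x. F x + k * G x) x = hess F x + k *\<^sub>R hess G x"
proof -
  have W: "open W" using assms(1) by (simp add: smooth_on_def)
  have p: "partial (\<lambda>x. A x + k * B x) i y = partial A i y + k * partial B i y"
    if "smooth_on W A" "smooth_on W B" "y \<in> W" for A B :: "real^'m \<Rightarrow> real" and i y
    using smooth_on_differentiable[OF that(1,3)] smooth_on_differentiable[OF that(2,3)]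
    by (simp add: partial_add partial_cmult)
  show "grad (\<lambda>x. F x + k * G x) x = grad F x + k *\<^sub>R grad G x"
    by (simp add: grad_def vec_eq_iff p[OF assms])
  have "partial (partial (\<lambda>x. F x + k * G x) j) i x = partial (partial F j) i x + k * partial (partial G j) i x" for i j
  proof -
    have "partial (partial (\<lambda>x. F x + k * G x) j) i x = partial (\<lambda>y. partial F j y + k * partial G j y) i x"
      by (rule partial_cong[OF W assms(3) p[OF assms(1,2)]])
    also have "\<dots> = partial (partial F j) i x + k * partial (partial G j) i x"
      using smooth_on_partial assms by (intro p)
    finally show ?thesis .
  qed
  then show "hess (\<lambda>x. F x + k * G x) x = hess F x + k *\<^sub>R hess G x"
    by (simp add: hess_def vec_eq_iff)
qed

lemma local_min_grad_hess:
  fixes f :: "real^'m \<Rightarrow> real"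
  assumes "smooth_on W f" "x \<in> W" "\<And>y. y \<in> W \<Longrightarrow> f x \<le> f y"
  shows "grad f x = 0" "0 \<le> v \<bullet> (hess f x *v v)"
proof -
  show "grad f x = 0" using local_min_partials(1)[OF assms] by (simp add: grad_def vec_eq_iff)
  show "0 \<le> v \<bullet> (hess f x *v v)"
    using local_min_partials(2)[OF assms, of v] partial_commute[OF assms(1,2)]
    by (simp add: inner_matrix_vector hess_def)
qed

lemma continuous_on_grad: "smooth_on W u \<Longrightarrow> continuous_on W (grad u)"
  unfolding grad_def[abs_def]
  by (intro continuous_on_vec_lambda smooth_on_continuous_on smooth_on_partial)

lemma continuous_on_hess: "smooth_on W u \<Longrightarrow> continuous_on W (hess u)"
  unfolding hess_def[abs_def]
  by (intro continuous_on_vec_lambda smooth_on_continuous_on smooth_on_partial)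

lemma continuous_on_matrix_vector_mult [continuous_intros]:
  fixes M :: "'a::topological_space \<Rightarrow> real^'m^'n"
  shows "continuous_on S M \<Longrightarrow> continuous_on S v \<Longrightarrow> continuous_on S (\<lambda>x. M x *v v x)"
  by (rule bounded_bilinear.continuous_on[OF bounded_bilinear_matrix_vector_mult])

lemma continuous_on_trace [continuous_intros]:
  fixes M :: "'a::topological_space \<Rightarrow> real^'m^'m"
  shows "continuous_on S M \<Longrightarrow> continuous_on S (\<lambda>x. trace (M x))"
  by (rule bounded_linear.continuous_on[OF bounded_linear_trace])

lemma continuous_on_soliton_drift: "smooth_on W u \<Longrightarrow> continuous_on W (soliton_drift c0 c u)"
  unfolding soliton_drift_def[abs_def]
  by (intro continuous_intros continuous_on_grad continuous_on_hess)

lemma continuous_on_hess_fst: "smooth_on W u \<Longrightarrow> continuous_on (W \<times> T) (\<lambda>z. hess u (fst z))"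
  by (rule continuous_on_compose2[OF continuous_on_hess continuous_on_fst]) (auto intro: continuous_intros)

lemma continuous_on_grad_fst: "smooth_on W u \<Longrightarrow> continuous_on (W \<times> T) (\<lambda>z. grad u (fst z))"
  by (rule continuous_on_compose2[OF continuous_on_grad continuous_on_fst]) (auto intro: continuous_intros)

text \<open>Continuity is joint in the point and in e, since e will not depend continuously on the
  point; compactness then bounds the remainder for all unit vectors at once.\<close>

lemma continuous_on_soliton_remainder:
  "smooth_on W u \<Longrightarrow> continuous_on (W \<times> T) (\<lambda>z. soliton_remainder c0 c u (fst z) (snd z))"
  unfolding soliton_remainder_def[abs_def] dhess_def[abs_def]
  by (intro continuous_intros continuous_on_vec_lambda continuous_on_hess_fst continuous_on_grad_fst smooth_on_partial)

text \<open>The smallest eigenvalue of the Hessian need not be differentiable, so the Hopf barrier is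
  compared with \<open>e \<bullet> hess u x e\<close> by minimising jointly over the point \<open>x\<close> and the unit vector \<open>e\<close>.\<close>

lemma hopf_touching_ball:
  fixes u :: "real^'m \<Rightarrow> real"
  assumes u: "smooth_on W u"
    and eqn: "\<And>y. y \<in> W \<Longrightarrow> graph_trace (grad u y) (hess u y)
        = (1 + grad u y \<bullet> grad u y) * (c0 + b \<bullet> grad u y)"
    and psd: "\<And>y v. y \<in> W \<Longrightarrow> 0 \<le> v \<bullet> (hess u y *v v)"
    and z: "z \<in> W" "norm e0 = 1" "e0 \<bullet> (hess u z *v e0) = 0"
    and \<rho>: "0 < \<rho>" "dist c z = \<rho>"
    and pos: "\<And>y e. y \<in> W \<Longrightarrow> dist c y \<le> \<rho> \<Longrightarrow> y \<noteq> z \<Longrightarrow> norm e = 1 \<Longrightarrow> 0 < e \<bullet> (hess u y *v e)"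
  shows False
proof -
  have W: "open W" using u by (simp add: smooth_on_def)
  define w where "w e y = e \<bullet> (hess u y *v e)" for e y
  obtain r0 where r0: "0 < r0" "cball z r0 \<subseteq> W" using W z(1) open_contains_cball by blast
  \<comment> \<open>A radius of at most \<rho> / 2 keeps the small ball away from the centre c,
    where the a^2 term of the barrier degenerates.\<close>
  define r where "r = min r0 (\<rho> / 2)"
  have r: "0 < r" "r \<le> \<rho> / 2" "cball z r \<subseteq> W" using r0 \<rho> by (auto simp: r_def)
  let ?S = "sphere (0::real^'m) 1"
  have contw: "continuous_on (W \<times> ?S) (\<lambda>z. w (snd z) (fst z))"
    unfolding w_def by (intro continuous_intros continuous_on_hess_fst u)
  have "continuous_on (cball z r \<times> ?S) (\<lambda>z. soliton_remainder c0 b u (fst z) (snd z))"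
    by (rule continuous_on_subset[OF continuous_on_soliton_remainder[OF u]]) (use r(3) in auto)
  then have "bounded ((\<lambda>z. soliton_remainder c0 b u (fst z) (snd z)) ` (cball z r \<times> ?S))"
    by (intro compact_imp_bounded compact_continuous_image compact_Times) auto
  then obtain B where B: "0 < B" "\<And>y e. y \<in> cball z r \<Longrightarrow> norm e = 1 \<Longrightarrow> \<bar>soliton_remainder c0 b u y e\<bar> \<le> B"
    unfolding bounded_pos by fastforce
  \<comment> \<open>The linear operator applied to the Gaussian is the Gaussian times X - 2 a
    \<kappa>, with X of order a^2; \<kappa> collects what is only linear in a.\<close>
  define \<kappa> where "\<kappa> y = (1 + grad u y \<bullet> grad u y) * CARD('m) - grad u y \<bullet> grad u y + soliton_drift c0 b u y \<bullet> (y - c)" for y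
  have "continuous_on (cball z r) \<kappa>"
    unfolding \<kappa>_def by (rule continuous_on_subset[OF _ r(3)])
      (intro continuous_intros continuous_on_grad continuous_on_soliton_drift u)
  then have "bounded (\<kappa> ` cball z r)"
    by (intro compact_imp_bounded compact_continuous_image) auto
  then obtain K where K: "0 < K" "\<And>y. y \<in> cball z r \<Longrightarrow> \<bar>\<kappa> y\<bar> \<le> K"
    unfolding bounded_pos by fastforce
  \<comment> \<open>Large enough for a^2 \<rho>^2, which will bound X from below, to beat 2 a K + B;
    the final 1 gives 1 \<le> a.\<close>
  define a where "a = (2 * K + B + 1) / \<rho>\<^sup>2 + 1"
  have a1: "1 \<le> a" using K B by (simp add: a_def)
  have a2: "2 * a * K + B < a\<^sup>2 * \<rho>\<^sup>2"
  proof -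
    have "a * \<rho>\<^sup>2 = 2 * K + B + 1 + \<rho>\<^sup>2" using \<rho> by (simp add: a_def field_simps)
    then have "a\<^sup>2 * \<rho>\<^sup>2 = a * (2 * K) + a * B + a * (1 + \<rho>\<^sup>2)" by (simp add: power2_eq_square algebra_simps)
    moreover have "1 * B \<le> a * B" using a1 B by (intro mult_right_mono) auto
    moreover have "0 < a * (1 + \<rho>\<^sup>2)" using a1 by (intro mult_pos_pos) (auto intro: add_pos_nonneg)
    ultimately show ?thesis by simp
  qed
  define G where "G = gauss_bump a c"
  define G0 where "G0 = exp (- (a * \<rho>\<^sup>2))"
  have G: "G y = exp (- (a * (dist c y)\<^sup>2))" for y
    by (simp add: G_def gauss_bump_def dist_norm power2_norm_eq_inner norm_minus_commute[of c])
  have Gpos: "0 < G y" "G y \<le> 1" for y using a1 by (auto simp: G)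
  have G0: "0 < G0" by (simp add: G0_def)
  have Gout: "G y < G0" if "\<rho> < dist c y" for y
  proof -
    have "\<rho>\<^sup>2 < (dist c y)\<^sup>2" using that \<rho> by (intro power_strict_mono) auto
    then show ?thesis using a1 by (simp add: G G0_def)
  qed
  have Gz: "G z = G0" by (simp add: G G0_def \<rho>)
  \<comment> \<open>On the part of the small sphere inside the closed ball around c the form is
    positive, since z is not on that sphere; compactness gives a uniform m. If that part is empty,
    any positive number serves.\<close>
  obtain m where m: "0 < m" "\<And>y e. y \<in> sphere z r \<Longrightarrow> dist c y \<le> \<rho> \<Longrightarrow> norm e = 1 \<Longrightarrow> m \<le> w e y"
  proof (cases "sphere z r \<inter> cball c \<rho> = {}")
    case True
    then have "\<not> dist c y \<le> \<rho>" if "y \<in> sphere z r" for y using that by auto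
    then show ?thesis using that[of 1] by (meson zero_less_one)
  next
    case False
    let ?C = "(sphere z r \<inter> cball c \<rho>) \<times> ?S"
    have sub: "sphere z r \<subseteq> W" using r(3) sphere_cball by blast
    have "continuous_on ?C (\<lambda>z. w (snd z) (fst z))"
      by (rule continuous_on_subset[OF contw]) (use sub in auto)
    moreover have "compact ?C" by (intro compact_Times compact_Int) auto
    moreover have "?C \<noteq> {}" using False z(2) by (auto simp: ex_in_conv[symmetric])
    ultimately obtain q where q: "q \<in> ?C" "\<And>q'. q' \<in> ?C \<Longrightarrow> w (snd q) (fst q) \<le> w (snd q') (fst q')"
      using continuous_attains_inf by meson
    have "fst q \<noteq> z" using q(1) r(1) by auto
    then have "0 < w (snd q) (fst q)"
      using q(1) sub unfolding w_def by (intro pos) auto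
    then show ?thesis using that[of "w (snd q) (fst q)"] q(2) by force
  qed
  \<comment> \<open>Vanishes on the sphere of radius \<rho> around c, hence at z; negative outside
    it, and below m inside because G is at most 1. So it lies below the form on the whole boundary
    of the small ball.\<close>
  define \<phi> where "\<phi> y = m * (G y - G0)" for y
  have bdry: "0 < w e y - \<phi> y" if "y \<in> sphere z r" "norm e = 1" for y e
  proof (cases "dist c y \<le> \<rho>")
    case True
    have "\<phi> y < m * 1" unfolding \<phi>_def using m(1) Gpos(2)[of y] G0 by (intro mult_strict_left_mono) auto
    then show ?thesis using m(2)[OF that(1) True that(2)] by simp
  next
    case False
    then have "\<phi> y < 0" unfolding \<phi>_def using m(1) Gout[of y] by (simp add: mult_pos_neg)
    moreover have "0 \<le> w e y" unfolding w_def using that r(3) by (intro psd) auto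
    ultimately show ?thesis by simp
  qed
  let ?K = "cball z r \<times> ?S"
  have "continuous_on UNIV G" unfolding G_def by (rule smooth_on_continuous_on[OF smooth_on_gauss_bump])
  then have contG: "continuous_on ?K (\<lambda>z. G (fst z))"
    by (rule continuous_on_compose2) (auto intro: continuous_intros)
  have "continuous_on ?K (\<lambda>z. w (snd z) (fst z))"
    by (rule continuous_on_subset[OF contw]) (use r(3) in auto)
  then have cont: "continuous_on ?K (\<lambda>z. w (snd z) (fst z) - \<phi> (fst z))"
    unfolding \<phi>_def by (intro continuous_intros contG)
  have comp: "compact ?K" by (intro compact_Times) auto
  have ne: "?K \<noteq> {}" using r z by (auto simp: ex_in_conv[symmetric])
  obtain q where q: "q \<in> ?K"
    "\<And>q'. q' \<in> ?K \<Longrightarrow> w (snd q) (fst q) - \<phi> (fst q) \<le> w (snd q') (fst q') - \<phi> (fst q')"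
    using continuous_attains_inf[OF comp ne cont] by blast
  define x e where "x = fst q" and "e = snd q"
  have xe: "x \<in> cball z r" "norm e = 1" using q(1) by (auto simp: x_def e_def)
  have min: "w e x - \<phi> x \<le> w v y - \<phi> y" if "y \<in> cball z r" "norm v = 1" for v y
    using q(2)[of "(y, v)"] that by (simp add: x_def e_def)
  \<comment> \<open>The pair (z, e0) gives the value 0, so the minimum is at most 0, while all
    boundary values are positive: the minimum is attained in the interior.\<close>
  have le0: "w e x \<le> \<phi> x"
    using min[of z e0] r z by (simp add: w_def \<phi>_def Gz)
  have xb: "x \<in> ball z r" using bdry[of x e] xe le0 by (cases "dist z x = r") auto
  have xW: "x \<in> W" using xe r(3) by blast
  have wx: "0 \<le> w e x" unfolding w_def by (rule psd[OF xW])
  \<comment> \<open>Minimality in the vector, for fixed x, makes e an eigenvector, as the twice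
    differentiated equation requires.\<close>
  have eig: "hess u x *v e = (e \<bullet> (hess u x *v e)) *\<^sub>R e"
    by (rule min_quadratic_form_eigenvector[OF transpose_hess[OF u xW] xe(2)])
       (use min[OF xe(1)] in \<open>simp add: w_def\<close>)
  have bW: "open (ball z r)" "ball z r \<subseteq> W" using r(3) ball_subset_cball by blast+
  have smw: "smooth_on (ball z r) (w e)"
    unfolding w_def[abs_def] by (rule smooth_on_subset[OF smooth_on_second_derivative[OF u] bW])
  have smG: "smooth_on (ball z r) G"
    unfolding G_def by (rule smooth_on_subset[OF smooth_on_gauss_bump bW(1)]) simp
  let ?f = "\<lambda>y. w e y + (- m) * G y"
  have smf: "smooth_on (ball z r) ?f" by (intro smooth_on_add smw smooth_on_cmult smG)
  \<comment> \<open>Minimality in the point, for fixed e; the constant m G0 of the barrier is left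
    out, as it does not affect derivatives.\<close>
  have fmin: "?f x \<le> ?f y" if "y \<in> ball z r" for y
    using min[of y e] that xe by (simp add: \<phi>_def algebra_simps)
  note lm = local_min_grad_hess[OF smf xb fmin]
  have gw: "grad (w e) x = m *\<^sub>R grad G x"
    using lm(1) unfolding grad_hess_linear_combination(1)[OF smw smG xb] by simp
  have "0 \<le> graph_trace (grad u x) (hess (w e) x - m *\<^sub>R hess G x)"
    by (rule graph_trace_nonneg)
       (use lm(2) in \<open>unfold grad_hess_linear_combination(2)[OF smw smG xb], simp\<close>)
  then have gt: "m * graph_trace (grad u x) (hess G x) \<le> graph_trace (grad u x) (hess (w e) x)"
    by (simp add: graph_trace_diff)
       (simp add: graph_trace_def trace_def sum_distrib_left scaleR_matrix_vector_assoc[symmetric] algebra_simps)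
  have main: "graph_trace (grad u x) (hess (w e) x) + soliton_drift c0 b u x \<bullet> grad (w e) x
     + w e x * soliton_remainder c0 b u x e = 0"
    unfolding w_def[abs_def] by (rule soliton_equation_second_derivative[OF u xW eqn xe(2) eig])
  define p d where "p = grad u x" and "d = x - c"
  \<comment> \<open>The zeroth-order term has no sign but is dominated by the barrier, because at x
    the form lies between 0 and \<phi>, and \<phi> is at most m G.\<close>
  have rem: "\<bar>w e x * soliton_remainder c0 b u x e\<bar> \<le> (m * G x) * B"
    unfolding abs_mult
  proof (rule mult_mono)
    have "\<phi> x \<le> m * G x" using m(1) G0 by (simp add: \<phi>_def)
    then show "\<bar>w e x\<bar> \<le> m * G x" using le0 wx by simp
  qed (use B xe m Gpos[of x] in auto)
  define X where "X = 4 * a\<^sup>2 * ((1 + p \<bullet> p) * (d \<bullet> d) - (p \<bullet> d)\<^sup>2)"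
  have gG: "graph_trace p (hess G x) = G x * (X - 2 * a * ((1 + p \<bullet> p) * CARD('m) - p \<bullet> p))"
    unfolding G_def d_def X_def by (rule graph_trace_hess_gauss_bump)
  have dr: "soliton_drift c0 b u x \<bullet> grad (w e) x = - (m * G x * (2 * a * (soliton_drift c0 b u x \<bullet> d)))"
    by (simp add: gw G_def grad_gauss_bump d_def)
  have "m * G x * (X - 2 * a * \<kappa> x - B)
      = m * graph_trace p (hess G x) + soliton_drift c0 b u x \<bullet> grad (w e) x - m * G x * B"
    unfolding gG dr by (simp add: p_def \<kappa>_def d_def algebra_simps)
  also have "\<dots> \<le> 0" using main gt rem unfolding p_def by linarith
  finally have "m * G x * (X - 2 * a * \<kappa> x - B) \<le> 0" .
  then have "X - 2 * a * \<kappa> x - B \<le> 0"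
    using mult_pos_pos[OF m(1) Gpos(1)[of x]] by (metis mult_pos_pos not_less)
  moreover have "2 * a * \<kappa> x \<le> 2 * a * K" using K(2)[OF xe(1)] a1 by (intro mult_left_mono) auto
  \<comment> \<open>Cauchy-Schwarz removes p, and |d| is at least \<rho> / 2 since x lies within
    \<rho> / 2 of z; the factor 4 cancels the square of 1/2.\<close>
  moreover have "a\<^sup>2 * \<rho>\<^sup>2 \<le> X"
  proof -
    have "(p \<bullet> d)\<^sup>2 \<le> (p \<bullet> p) * (d \<bullet> d)" by (rule Cauchy_Schwarz_ineq)
    then have "d \<bullet> d \<le> (1 + p \<bullet> p) * (d \<bullet> d) - (p \<bullet> d)\<^sup>2" by (simp add: algebra_simps)
    moreover have "(\<rho> / 2)\<^sup>2 \<le> d \<bullet> d"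
    proof -
      have "dist c z \<le> dist c x + dist z x" by (metis dist_triangle2)
      then have "\<rho> / 2 \<le> norm d" using xe(1) r(2) \<rho> by (simp add: d_def dist_norm norm_minus_commute)
      then have "(\<rho> / 2)\<^sup>2 \<le> (norm d)\<^sup>2" using \<rho> by (intro power_mono) auto
      then show ?thesis by (simp add: power2_norm_eq_inner)
    qed
    ultimately have "(\<rho> / 2)\<^sup>2 \<le> (1 + p \<bullet> p) * (d \<bullet> d) - (p \<bullet> d)\<^sup>2" by linarith
    then have "4 * a\<^sup>2 * (\<rho> / 2)\<^sup>2 \<le> 4 * a\<^sup>2 * ((1 + p \<bullet> p) * (d \<bullet> d) - (p \<bullet> d)\<^sup>2)"
      by (intro mult_left_mono) auto
    then show ?thesis by (simp add: X_def power_divide)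
  qed
  ultimately show False using a2 by linarith
qed

text \<open>Given a nondegenerate y1, take a degenerate point z nearest to it: the open ball around
  y1 through z contains no degenerate point, which Hopf's argument at z excludes. Halving R keeps
  the ball around y1 through y0 inside W.\<close>

lemma degenerate_hessian_spreads:
  fixes u :: "real^'m \<Rightarrow> real"
  assumes u: "smooth_on W u"
    and eqn: "\<And>y. y \<in> W \<Longrightarrow> graph_trace (grad u y) (hess u y)
        = (1 + grad u y \<bullet> grad u y) * (c0 + b \<bullet> grad u y)"
    and psd: "\<And>y v. y \<in> W \<Longrightarrow> 0 \<le> v \<bullet> (hess u y *v v)"
    and ball: "ball y0 R \<subseteq> W" "det (hess u y0) = 0" "y1 \<in> ball y0 (R / 2)"
  shows "det (hess u y1) = 0"
proof (rule ccontr)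
  assume ndeg: "det (hess u y1) \<noteq> 0"
  have deg: "det (hess u y) = 0 \<longleftrightarrow> (\<exists>e. norm e = 1 \<and> e \<bullet> (hess u y *v e) = 0)" if "y \<in> W" for y
    by (rule det_eq_0_iff_psd[OF transpose_hess[OF u that] psd[OF that]])
  let ?D = "cball y1 (dist y1 y0)"
  have sub: "?D \<subseteq> W"
  proof
    fix y assume "y \<in> ?D"
    then have "dist y0 y < R"
      using ball(3) dist_triangle[of y0 y y1] by (simp add: dist_commute)
    then show "y \<in> W" using ball(1) by auto
  qed
  define Z where "Z = {y \<in> ?D. det (hess u y) = 0}"
  have "continuous_on ?D (\<lambda>y. det (hess u y))"
    unfolding det_def
    by (intro continuous_intros continuous_on_subset[OF continuous_on_hess[OF u] sub])
  then have "closed Z"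
    unfolding Z_def using continuous_closed_preimage_constant[of ?D "\<lambda>y. det (hess u y)" 0] by simp
  moreover have "y0 \<in> Z" using ball(2) by (simp add: Z_def)
  ultimately obtain z where z: "z \<in> Z" "\<And>y. y \<in> Z \<Longrightarrow> dist y1 z \<le> dist y1 y"
    using distance_attains_inf[of Z y1] by blast
  have "z \<noteq> y1" using z(1) ndeg by (auto simp: Z_def)
  \<comment> \<open>The ball with half the radius touches the sphere around y1 at z only, so that z
    is the only degenerate point even of the closed ball.\<close>
  define c where "c = midpoint y1 z"
  define \<rho> where "\<rho> = dist y1 z / 2"
  have \<rho>: "0 < \<rho>" "dist c z = \<rho>" "dist y1 c = \<rho>"
    using \<open>z \<noteq> y1\<close> by (simp_all add: \<rho>_def c_def dist_midpoint)
  have zW: "z \<in> W" using z(1) sub by (auto simp: Z_def)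
  obtain e0 where e0: "norm e0 = 1" "e0 \<bullet> (hess u z *v e0) = 0"
    using z(1) deg[OF zW] by (auto simp: Z_def)
  have pos: "0 < e \<bullet> (hess u y *v e)" if y: "y \<in> W" "dist c y \<le> \<rho>" "y \<noteq> z" "norm e = 1" for y e
  proof -
    have "dist y1 y < dist y1 z"
    proof (rule ccontr)
      assume "\<not> dist y1 y < dist y1 z"
      then have *: "2 * \<rho> \<le> norm (y - y1)" by (simp add: \<rho>_def dist_norm norm_minus_commute)
      have zc: "z - c = c - y1" by (simp add: c_def midpoint_def algebra_simps flip: scaleR_add_left)
      have nc: "norm (c - y1) = \<rho>" using \<rho>(3) by (simp add: dist_norm norm_minus_commute)
      have ny: "norm (y - c) \<le> \<rho>" using y(2) by (simp add: dist_norm norm_minus_commute)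
      \<comment> \<open>The parallelogram law around c: a point of the half-size ball at distance at
        least 2 \<rho> from y1 has to be z.\<close>
      have par: "(norm ((y - c) - (c - y1)))\<^sup>2 + (norm ((y - c) + (c - y1)))\<^sup>2 = 2 * (norm (y - c))\<^sup>2 + 2 * (norm (c - y1))\<^sup>2"
        unfolding power2_norm_eq_inner inner_diff_left[of "y - c" "c - y1"] inner_diff_right[of _ "y - c" "c - y1"]
          inner_add_left[of "y - c" "c - y1"] inner_add_right[of _ "y - c" "c - y1"] by simp
      have "(2 * \<rho>)\<^sup>2 \<le> (norm (y - y1))\<^sup>2" using * \<rho>(1) by (intro power_mono) auto
      moreover have "(norm (y - c))\<^sup>2 \<le> \<rho>\<^sup>2" using ny by (intro power_mono) auto
      ultimately have "(norm ((y - c) - (z - c)))\<^sup>2 \<le> 0"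
        using par nc by (simp add: zc power2_eq_square)
      then show False using y(3) by simp
    qed
    then have "y \<notin> Z" using z(2) by force
    moreover have "y \<in> ?D" using \<open>dist y1 y < dist y1 z\<close> z(2)[OF \<open>y0 \<in> Z\<close>] by simp
    ultimately have "det (hess u y) \<noteq> 0" by (simp add: Z_def)
    then have "e \<bullet> (hess u y *v e) \<noteq> 0" using deg[OF y(1)] y(4) by blast
    then show ?thesis using psd[OF y(1), of e] by linarith
  qed
  show False by (rule hopf_touching_ball[OF u eqn psd zW e0 \<rho>(1,2) pos])
qed

section \<open>Local graphs and change of chart\<close>

definition jacobian :: "(real^'m \<Rightarrow> real^'k) \<Rightarrow> real^'m \<Rightarrow> real^'m^'k" where
  "jacobian T y = (\<chi> k i. partial (\<lambda>y. T y $ k) i y)"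

lemma frechet_derivative_eq_jacobian:
  assumes "T differentiable (at y)"
  shows "frechet_derivative T (at y) v = jacobian T y *v v"
  unfolding frechet_derivative_eq_sum_partial[OF assms]
  by (simp add: vec_eq_iff jacobian_def matrix_vector_mult_def partial_nth[OF assms] mult.commute)

text \<open>The inverse function theorem gives a differentiable \<open>R\<close>, and smoothness is
  bootstrapped: the partial derivatives of \<open>R\<close> are entries of the inverse Jacobian,
  that is, smooth functions composed with \<open>R\<close>, so each order of differentiability
  yields the next.\<close>

lemma smooth_inverse_function:
  fixes T :: "real^'m \<Rightarrow> real^'m"
  assumes W: "open W" and T: "\<And>k. smooth_on W (\<lambda>x. T x $ k)"
    and x0: "x0 \<in> W" and inj: "inj (frechet_derivative T (at x0))"
  obtains W' V R where "open W'" "W' \<subseteq> W" "x0 \<in> W'" "open V" "T x0 \<in> V" "homeomorphism W' V T R"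
    "\<And>k. smooth_on V (\<lambda>y. R y $ k)"
proof -
  have dT: "T differentiable (at x)" if "x \<in> W" for x
    by (rule differentiable_vec) (rule smooth_on_differentiable[OF T that])
  define D where "D x = Blinfun (frechet_derivative T (at x))" for x
  have D: "blinfun_apply (D x) = frechet_derivative T (at x)" if "x \<in> W" for x
    unfolding D_def using dT[OF that]
    by (intro bounded_linear_Blinfun_apply) (metis frechet_derivative_works has_derivative_bounded_linear)
  have derT: "(T has_derivative blinfun_apply (D x)) (at x)" if "x \<in> W" for x
    using dT[OF that] by (simp add: D[OF that] frechet_derivative_works)
  have contD: "continuous_on W D"
  proof (rule continuous_on_blinfun_componentwise)
    fix b :: "real^'m" assume "b \<in> Basis"
    have "continuous_on W (\<lambda>x. jacobian T x *v b)"
      unfolding jacobian_def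
      by (intro continuous_intros continuous_on_vec_lambda smooth_on_continuous_on[OF smooth_on_partial[OF T]])
    then show "continuous_on W (\<lambda>x. blinfun_apply (D x) b)"
      by (rule continuous_on_eq) (simp add: D frechet_derivative_eq_jacobian dT)
  qed
  have lin: "linear (frechet_derivative T (at x0))"
    using dT[OF x0] by (simp add: linear_frechet_derivative)
  obtain L where L: "linear L" "L \<circ> frechet_derivative T (at x0) = id"
    using linear_injective_left_inverse[OF lin inj] by blast
  have "Blinfun L o\<^sub>L D x0 = id_blinfun"
    using L by (intro blinfun_eqI)
      (simp add: D[OF x0] bounded_linear_Blinfun_apply linear_conv_bounded_linear pointfree_idE)
  from inverse_function_theorem[OF W derT contD x0 this]
  obtain W' V R R' where R: "open W'" "W' \<subseteq> W" "x0 \<in> W'" "open V" "T x0 \<in> V" "homeomorphism W' V T R"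
    "\<And>y. y \<in> V \<Longrightarrow> (R has_derivative (R' y)) (at y)"
    "\<And>y. y \<in> V \<Longrightarrow> R' y = inv (blinfun_apply (D (R y)))"
    "\<And>y. y \<in> V \<Longrightarrow> bij (blinfun_apply (D (R y)))" by metis
  have RV: "R y \<in> W'" if "y \<in> V" for y using R(6) that by (auto simp: homeomorphism_def)
  have VR: "\<exists>y\<in>V. x = R y" if "x \<in> W'" for x using R(6) that by (force simp: homeomorphism_def)
  let ?A = "jacobian T"
  have A: "blinfun_apply (D (R y)) v = ?A (R y) *v v" if "y \<in> V" for y v
    using RV[OF that] R(2) by (auto simp: D frechet_derivative_eq_jacobian dT)
  have detA: "det (?A x) \<noteq> 0" if x: "x \<in> W'" for x
  proof -
    obtain y where y: "y \<in> V" "x = R y" using VR[OF x] by blast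
    have "bij ((*v) (?A x))" using R(9)[OF y(1)] A[OF y(1)] by (simp add: y(2) fun_eq_iff[symmetric] cong: bij_betw_cong)
    then show ?thesis
      by (metis bij_is_inj det_eq_0_iff_kernel inj_onD matrix_vector_mult_0_right norm_zero UNIV_I zero_neq_one)
  qed
  \<comment> \<open>Cramer's rule for entry (k, i) of the inverse Jacobian: a quotient of
    polynomials in the entries of the Jacobian, hence smooth in x.\<close>
  define q where "q k i x = det (\<chi> r j. if j = k then axis i 1 $ r else ?A x $ r $ j) * inverse (det (?A x))" for k i :: 'm and x
  have q: "partial (\<lambda>y. R y $ k) i y = q k i (R y)" if y: "y \<in> V" for y k i
  proof -
    have "?A (R y) *v (R' y (axis i 1)) = axis i 1"
      using A[OF y] R(8,9)[OF y] by (metis bij_is_surj surj_f_inv_f)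
    then have "R' y (axis i 1) $ k = q k i (R y)"
      unfolding cramer[OF detA[OF RV[OF y]]] by (simp add: q_def divide_inverse)
    moreover have "partial (\<lambda>y. R y $ k) i y = R' y (axis i 1) $ k"
      using partial_nth[of R y k i] partial_eq[OF R(7)[OF y]] R(7)[OF y] by (metis differentiable_def)
    ultimately show ?thesis by simp
  qed
  have Aij: "diff_upto n W' (\<lambda>x. ?A x $ r $ j)" for n r j
    using smooth_on_subset[OF smooth_on_partial[OF T] R(1,2)] by (simp add: jacobian_def smooth_on_iff_diff_upto)
  have dq: "diff_upto n W' (q k i)" for n k i
  proof -
    have "diff_upto n W' (\<lambda>x. (\<chi> r j. if j = k then axis i 1 $ r else ?A x $ r $ j) $ r $ j)" for r j
      using Aij by (cases "j = k") (auto simp: diff_upto_const)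
    then show ?thesis unfolding q_def
      by (intro diff_upto_mult diff_upto_inverse diff_upto_det R(1) Aij detA)
  qed
  have "diff_upto n V (\<lambda>y. R y $ k)" for n k
  proof (induction n arbitrary: k)
    case 0
    have "(\<lambda>y. R y $ k) differentiable (at y)" if "y \<in> V" for y
      using bounded_linear.has_derivative[OF bounded_linear_vec_nth R(7)[OF that]] differentiable_def by blast
    then show ?case by simp
  next
    case (Suc n)
    have "diff_upto n V (\<lambda>y. q k i (R y))" for i
      by (rule diff_upto_compose[OF R(4) _ Suc dq]) (use RV in blast)
    then have "diff_upto n V (partial (\<lambda>y. R y $ k) i)" for i
      by (rule diff_upto_cong[OF R(4), rotated]) (simp add: q)
    then show ?case using diff_upto_differentiable[OF Suc[of k]] by simp
  qed
  then have "smooth_on V (\<lambda>y. R y $ k)" for k using R(4) by (simp add: smooth_on_iff_diff_upto)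
  then show ?thesis using that R(1-6) by blast
qed

text \<open>In the second-order chain rule the second derivatives of \<open>T\<close> are multiplied
  by \<open>grad f\<close>, which vanishes at \<open>T y\<close>.\<close>

lemma hess_compose_critical:
  fixes T :: "real^'m \<Rightarrow> real^'k" and f :: "real^'k \<Rightarrow> real"
  assumes V: "open V" and T: "\<And>k. smooth_on V (\<lambda>y. T y $ k)" "T ` V \<subseteq> W"
    and f: "smooth_on W f" and y: "y \<in> V" and crit: "grad f (T y) = 0"
  shows "hess (\<lambda>y. f (T y)) y = transpose (jacobian T y) ** hess f (T y) ** jacobian T y"
proof -
  have dT: "T differentiable (at y)" if "y \<in> V" for y
    by (rule differentiable_vec) (rule smooth_on_differentiable[OF T(1) that])
  have inW: "T y \<in> W" if "y \<in> V" for y using T(2) that by blast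
  have p0: "partial f k (T y) = 0" for k
    using crit by (simp add: grad_def vec_eq_iff)
  have pc: "partial (\<lambda>y. g (T y)) i z = (\<Sum>k\<in>UNIV. partial (\<lambda>y. T y $ k) i z * partial g k (T z))"
    if "smooth_on W g" "z \<in> V" for g :: "real^'k \<Rightarrow> real" and z i
    using partial_compose[OF dT[OF that(2)] smooth_on_differentiable[OF that(1) inW[OF that(2)]]] by simp
  have "partial (partial (\<lambda>y. f (T y)) j) i y =
     (\<Sum>k\<in>UNIV. (\<Sum>l\<in>UNIV. partial (\<lambda>y. T y $ l) i y * partial (partial f k) l (T y)) * partial (\<lambda>y. T y $ k) j y)" for i j
  proof -
    have d1: "partial (\<lambda>y. T y $ k) j differentiable (at y)" for k
      by (rule smooth_on_differentiable[OF smooth_on_partial[OF T(1)] y])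
    have d2: "(\<lambda>z. partial f k (T z)) differentiable (at y)" for k
      using differentiable_chain_at[OF dT[OF y] smooth_on_differentiable[OF smooth_on_partial[OF f] inW[OF y]]]
      by (simp add: o_def)
    have "partial (partial (\<lambda>y. f (T y)) j) i y =
       partial (\<lambda>z. \<Sum>k\<in>UNIV. partial (\<lambda>y. T y $ k) j z * partial f k (T z)) i y"
      by (rule partial_cong[OF V y pc[OF f]])
    also have "\<dots> = (\<Sum>k\<in>UNIV. partial (\<lambda>z. partial (\<lambda>y. T y $ k) j z * partial f k (T z)) i y)"
      by (rule partial_sum) (auto intro: differentiable_mult d1 d2)
    also have "\<dots> = (\<Sum>k\<in>UNIV. partial (\<lambda>y. T y $ k) j y * partial (\<lambda>z. partial f k (T z)) i y)"
      by (simp add: partial_mult[OF d1 d2] p0)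
    also have "\<dots> = (\<Sum>k\<in>UNIV. (\<Sum>l\<in>UNIV. partial (\<lambda>y. T y $ l) i y * partial (partial f k) l (T y)) * partial (\<lambda>y. T y $ k) j y)"
      by (simp add: pc[OF smooth_on_partial[OF f] y] mult.commute)
    finally show ?thesis .
  qed
  then show ?thesis
    by (simp add: vec_eq_iff hess_def jacobian_def matrix_matrix_mult_def transpose_def)
qed

section \<open>Fundamental forms of a parametrised hypersurface\<close>

definition first_form :: "(real^'m \<Rightarrow> 'b::real_inner) \<Rightarrow> real^'m \<Rightarrow> real^'m^'m" where
  "first_form F x = (\<chi> i j. partial F i x \<bullet> partial F j x)"

definition second_form :: "(real^'m \<Rightarrow> 'b::real_inner) \<Rightarrow> (real^'m \<Rightarrow> 'b) \<Rightarrow> real^'m \<Rightarrow> real^'m^'m" where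
  "second_form F \<nu> x = (\<chi> i j. - (partial (partial F j) i x \<bullet> \<nu> x))"

text \<open>On the right the normal is a constant vector, so no derivative of \<nu> enters; with
  \<open>grad_normal_component\<close> this exhibits the second form as minus a Hessian at a
  critical point.\<close>

lemma second_form_eq_hess:
  assumes "smooth_on W F" "x \<in> W"
  shows "second_form F \<nu> x = - hess (\<lambda>z. F z \<bullet> \<nu> x) x"
  by (simp add: second_form_def hess_def vec_eq_iff partial_partial_inner_const[OF assms])

lemma grad_normal_component:
  assumes "smooth_on W F" "x \<in> W" "\<And>i. partial F i x \<bullet> \<zeta> = 0"
  shows "grad (\<lambda>z. F z \<bullet> \<zeta>) x = 0"
  by (simp add: grad_def vec_eq_iff partial_inner_const[OF smooth_on_differentiable[OF assms(1,2)]] assms(3))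

lemma first_form_compose:
  assumes "T differentiable (at y)" "F differentiable (at (T y))"
  shows "first_form (\<lambda>y. F (T y)) y = transpose (jacobian T y) ** first_form F (T y) ** jacobian T y"
proof -
  have "partial (\<lambda>y. F (T y)) i y \<bullet> partial (\<lambda>y. F (T y)) j y =
     (\<Sum>k\<in>UNIV. (\<Sum>l\<in>UNIV. partial (\<lambda>y. T y $ l) i y * (partial F l (T y) \<bullet> partial F k (T y))) * partial (\<lambda>y. T y $ k) j y)" for i j
    unfolding partial_compose[OF assms]
    by (simp add: inner_sum_left inner_sum_right sum_distrib_left sum_distrib_right mult_ac)
  then show ?thesis
    by (simp add: vec_eq_iff first_form_def jacobian_def matrix_matrix_mult_def transpose_def)
qed

lemma inner_first_form:
  assumes "F differentiable (at x)"
  shows "v \<bullet> (first_form F x *v v) = frechet_derivative F (at x) v \<bullet> frechet_derivative F (at x) v"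
  unfolding frechet_derivative_eq_sum_partial[OF assms]
  by (simp add: inner_matrix_vector first_form_def inner_sum_left inner_sum_right sum_distrib_left mult_ac inner_commute)

text \<open>A unit kernel vector e of the Gram matrix satisfies |DF e|^2 = 0, against
  injectivity.\<close>

lemma det_first_form:
  assumes "F differentiable (at x)" "inj (frechet_derivative F (at x))"
  shows "det (first_form F x) \<noteq> 0"
proof
  assume "det (first_form F x) = 0"
  then obtain e where e: "norm e = 1" "first_form F x *v e = 0" by (auto simp: det_eq_0_iff_kernel)
  then have "frechet_derivative F (at x) e = 0" using inner_first_form[OF assms(1), of e] by simp
  moreover have "frechet_derivative F (at x) 0 = 0"
    using linear_0[OF linear_frechet_derivative[OF assms(1)]] .
  ultimately have "e = 0" using assms(2) by (metis injD)
  then show False using e(1) by simp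
qed

lemma matrix_inv_eqI:
  fixes A :: "real^'n^'n"
  assumes "B ** A = mat 1"
  shows "matrix_inv A = B"
proof -
  have "A ** B = mat 1" using assms matrix_left_right_inverse by blast
  then have "\<exists>A'. A ** A' = mat 1 \<and> A' ** A = mat 1" using assms by blast
  then have *: "A ** matrix_inv A = mat 1 \<and> matrix_inv A ** A = mat 1"
    unfolding matrix_inv_def by (rule someI_ex)
  have "matrix_inv A = (B ** A) ** matrix_inv A" by (simp add: assms)
  also have "\<dots> = B" using * by (simp add: matrix_mul_assoc[symmetric])
  finally show ?thesis .
qed

text \<open>The trace of g^-1 h does not change when both forms are pulled back by an invertible
  \<open>J\<close>, so it can be computed with the metric I + p p^T of a graph.\<close>

lemma trace_inverse_graph_metric:
  fixes g h J :: "real^'m^'m"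
  assumes g: "transpose J ** g ** J = mat 1 + (\<chi> i j. p $ i * p $ j)" and h: "transpose J ** h ** J = s *\<^sub>R H"
  shows "(1 + p \<bullet> p) * trace (matrix_inv g ** h) = s * graph_trace p H"
    "det J \<noteq> 0"
proof -
  define P where "P = (\<chi> i j. p $ i * p $ j)"
  define k where "k = 1 + p \<bullet> p"
  have k: "0 < k" by (simp add: k_def add_pos_nonneg)
  \<comment> \<open>The Sherman-Morrison inverse of I + p p^T.\<close>
  define N where "N = mat 1 - (1 / k) *\<^sub>R P"
  have Pv: "P *v v = (p \<bullet> v) *\<^sub>R p" for v
    by (simp add: P_def vec_eq_iff matrix_vector_mult_def inner_vec_def sum_distrib_left sum_distrib_right mult_ac)
  have "(N ** (mat 1 + P)) *v v = mat 1 *v v" for v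
  proof -
    have "(N ** (mat 1 + P)) *v v = N *v (v + (p \<bullet> v) *\<^sub>R p)"
      by (simp add: matrix_vector_mul_assoc[symmetric] matrix_vector_mult_add_rdistrib Pv)
    also have "\<dots> = v + (p \<bullet> v) *\<^sub>R p - (1 / k * (p \<bullet> v * k)) *\<^sub>R p"
      by (simp add: N_def matrix_vector_mult_diff_rdistrib scaleR_matrix_vector_assoc[symmetric] Pv
          inner_add_right k_def distrib_left)
    finally show ?thesis using k by simp
  qed
  then have NM: "N ** (mat 1 + P) = mat 1" by (simp add: matrix_eq)
  \<comment> \<open>The pulled-back metric is invertible, hence so is each of its factors,
    \<open>J\<close> included.\<close>
  have "det N * det (transpose J ** g ** J) = 1"
    by (metis NM g P_def det_mul det_I)
  then show J: "det J \<noteq> 0" by (auto simp: det_mul)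
  then obtain J' where J': "J ** J' = mat 1" by (metis invertible_def invertible_det_nz)
  have "(J ** N ** transpose J) ** g = (J ** N ** transpose J) ** g ** (J ** J')"
    by (simp add: J')
  also have "\<dots> = J ** (N ** (transpose J ** g ** J)) ** J'"
    by (simp add: matrix_mul_assoc)
  also have "\<dots> = mat 1" by (simp add: g P_def[symmetric] NM J')
  finally have "matrix_inv g = J ** N ** transpose J" by (rule matrix_inv_eqI)
  then have "trace (matrix_inv g ** h) = trace (J ** (N ** transpose J ** h))"
    by (simp add: matrix_mul_assoc)
  also have "\<dots> = trace ((N ** transpose J ** h) ** J)" by (rule trace_mul_sym)
  also have "\<dots> = trace (N ** (s *\<^sub>R H))" by (simp add: h[symmetric] matrix_mul_assoc)
  also have "N ** (s *\<^sub>R H) = s *\<^sub>R H - (s / k) *\<^sub>R (P ** H)"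
    unfolding matrix_eq
    by (simp add: N_def matrix_vector_mul_assoc[symmetric] matrix_vector_mult_diff_rdistrib
        scaleR_matrix_vector_assoc[symmetric] matrix_vector_mult_scaleR scaleR_diff_right)
  also have "trace (s *\<^sub>R H - (s / k) *\<^sub>R (P ** H)) = s * (trace H - trace (P ** H) / k)"
    by (simp add: linear_diff[OF bounded_linear.linear[OF bounded_linear_trace]]
        linear_cmul[OF bounded_linear.linear[OF bounded_linear_trace]] algebra_simps)
  also have "trace (P ** H) = p \<bullet> (H *v p)"
    unfolding trace_def matrix_matrix_mult_def inner_matrix_vector
    by (subst sum.swap) (simp add: P_def mult_ac)
  finally have "k * trace (matrix_inv g ** h) = s * (k * trace H - p \<bullet> (H *v p))"
    using k by (simp add: field_simps)
  then show "(1 + p \<bullet> p) * trace (matrix_inv g ** h) = s * graph_trace p H"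
    by (simp add: k_def graph_trace_def)
qed

text \<open>An orthogonal map carrying the last basis vector to n carries the others to a frame of
  its orthogonal complement. Orthonormality is stated as Parseval's identity, the form in which it
  is applied.\<close>

lemma orthonormal_frame_with_normal:
  fixes n :: "real^('m::finite + 1)"
  assumes "norm n = 1"
  obtains t :: "'m \<Rightarrow> real^('m + 1)" where
    "\<And>X Y. X \<bullet> Y = (\<Sum>k\<in>UNIV. (X \<bullet> t k) * (Y \<bullet> t k)) + (X \<bullet> n) * (Y \<bullet> n)"
proof -
  obtain Q :: "real^('m + 1) \<Rightarrow> real^('m + 1)" where Q: "orthogonal_transformation Q" "Q (axis (Inr 1) 1) = n"
    by (rule orthogonal_transformation_exists[of "axis (Inr 1) 1" n]) (use assms in auto)
  have inner: "Q v \<bullet> Q w = v \<bullet> w" for v w using Q(1) by (simp add: orthogonal_transformation_def)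
  have surj: "\<exists>v. X = Q v" for X
    using orthogonal_transformation_surj[OF Q(1)] by (metis surjD)
  define t where "t k = Q (axis (Inl k) 1)" for k
  show ?thesis
  proof (rule that[of t])
    fix X Y
    obtain v w where vw: "X = Q v" "Y = Q w" using surj by blast
    have "v \<bullet> w = (\<Sum>i\<in>UNIV <+> UNIV. v $ i * w $ i)"
      by (simp only: UNIV_Plus_UNIV inner_vec_def inner_real_def)
    also have "\<dots> = (\<Sum>k\<in>UNIV. v $ Inl k * w $ Inl k) + v $ Inr 1 * w $ Inr 1"
      by (subst sum.Plus) simp_all
    finally show "X \<bullet> Y = (\<Sum>k\<in>UNIV. (X \<bullet> t k) * (Y \<bullet> t k)) + (X \<bullet> n) * (Y \<bullet> n)"
      by (simp add: vw Q(2)[symmetric] t_def inner inner_axis)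
  qed
qed

lemma det_scaleR_eq_0_iff:
  fixes M :: "real^'m^'m"
  shows "c \<noteq> 0 \<Longrightarrow> det (c *\<^sub>R M) = 0 \<longleftrightarrow> det M = 0"
  unfolding det_eq_0_iff_kernel by (simp add: scaleR_matrix_vector_assoc[symmetric])

lemma inner_congruent_matrix:
  fixes M :: "real^'m^'m" and J :: "real^'n^'m"
  shows "v \<bullet> ((transpose J ** M ** J) *v v) = (J *v v) \<bullet> (M *v (J *v v))"
proof -
  have "v \<bullet> ((transpose J ** M ** J) *v v) = (M *v (J *v v) v* J) \<bullet> v"
    by (simp add: matrix_vector_mul_assoc[symmetric] inner_commute)
  also have "\<dots> = (M *v (J *v v)) \<bullet> (J *v v)" by (rule dot_lmul_matrix)
  finally show ?thesis by (simp add: inner_commute)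
qed

lemma hess_affine_plus:
  fixes u :: "real^'m \<Rightarrow> real"
  assumes u: "smooth_on V u" and y: "y \<in> V"
  shows "grad (\<lambda>y. a \<bullet> y + k * u y) y = a + k *\<^sub>R grad u y"
    "hess (\<lambda>y. a \<bullet> y + k * u y) y = k *\<^sub>R hess u y"
proof -
  have pa: "partial (\<lambda>y. a \<bullet> y) i = (\<lambda>y. a $ i)" for i
    using partial_eq[OF has_derivative_inner_right[OF has_derivative_ident, of a]]
    by (auto simp: inner_axis)
  have "(\<lambda>y. a \<bullet> y) differentiable (at y)" for y
    using has_derivative_inner_right[OF has_derivative_ident, of a] differentiable_def by blast
  then have "diff_upto n V (\<lambda>y. a \<bullet> y)" for n
    by (cases n) (auto simp: pa diff_upto_const)
  then have a: "smooth_on V (\<lambda>y. a \<bullet> y)"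
    using u by (simp add: smooth_on_iff_diff_upto)
  show "grad (\<lambda>y. a \<bullet> y + k * u y) y = a + k *\<^sub>R grad u y"
    unfolding grad_hess_linear_combination(1)[OF a u y] by (simp add: grad_def pa)
  show "hess (\<lambda>y. a \<bullet> y + k * u y) y = k *\<^sub>R hess u y"
    unfolding grad_hess_linear_combination(2)[OF a u y] by (simp add: hess_def pa vec_eq_iff)
qed

text \<open>The hypersurface is written as a graph over its tangent hyperplane at \<open>x0\<close>. With graph
  function \<open>u\<close> in the direction \<open>n = - \<nu> x0\<close>, the second fundamental form is a positive multiple of
  the Hessian of \<open>u\<close>, and the soliton equation is affine in the gradient of \<open>u\<close> whichever direction
  \<open>n\<close> has; hence no case distinction on the sign of the mean curvature is needed.\<close>

lemma soliton_degeneracy_open: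
  fixes F \<nu> :: "real^'m \<Rightarrow> real^('m::finite + 1)"
  assumes F: "smooth_on W F"
    and inj: "\<And>x. x \<in> W \<Longrightarrow> inj (frechet_derivative F (at x))"
    and \<nu>: "continuous_on W \<nu>" "\<And>x. x \<in> W \<Longrightarrow> norm (\<nu> x) = 1"
    and perp: "\<And>x i. x \<in> W \<Longrightarrow> partial F i x \<bullet> \<nu> x = 0"
    and soliton: "\<And>x. x \<in> W \<Longrightarrow> trace (matrix_inv (first_form F x) ** second_form F \<nu> x) = - (b \<bullet> \<nu> x)"
    and psd: "\<And>x v. x \<in> W \<Longrightarrow> 0 \<le> v \<bullet> (second_form F \<nu> x *v v)"
    and x0: "x0 \<in> W" "det (second_form F \<nu> x0) = 0"
  obtains N where "open N" "x0 \<in> N" "N \<subseteq> W" "\<And>x. x \<in> N \<Longrightarrow> det (second_form F \<nu> x) = 0"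
proof -
  have W: "open W" using F by (simp add: smooth_on_def)
  define n where "n = - \<nu> x0"
  have n1: "norm n = 1" by (simp add: n_def \<nu>(2)[OF x0(1)])
  obtain t :: "'m \<Rightarrow> real^('m + 1)" where
    t: "\<And>X Y. X \<bullet> Y = (\<Sum>k\<in>UNIV. (X \<bullet> t k) * (Y \<bullet> t k)) + (X \<bullet> n) * (Y \<bullet> n)"
    using orthonormal_frame_with_normal[OF n1] by metis
  \<comment> \<open>Orthogonal projection to the tangent hyperplane in the frame t. Its local
    inverse R makes y the coordinates of a graph: F (R y) is the sum of the y_k t_k plus u(y)
    n.\<close>
  define T where "T x = (\<chi> k. F x \<bullet> t k)" for x
  have T: "smooth_on W (\<lambda>x. T x $ k)" for k
    unfolding T_def using smooth_on_inner_const[OF F] by simp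
  have dF: "F differentiable (at x)" if "x \<in> W" for x by (rule smooth_on_differentiable[OF F that])
  have dT: "T differentiable (at x)" if "x \<in> W" for x
    by (rule differentiable_vec) (rule smooth_on_differentiable[OF T that])
  have DT: "frechet_derivative T (at x0) v $ k = frechet_derivative F (at x0) v \<bullet> t k" for v k
  proof -
    have "frechet_derivative T (at x0) v $ k = (\<Sum>i\<in>UNIV. v $ i * partial T i x0 $ k)"
      by (simp add: frechet_derivative_eq_sum_partial[OF dT[OF x0(1)]])
    also have "\<dots> = (\<Sum>i\<in>UNIV. v $ i * (partial F i x0 \<bullet> t k))"
      using partial_nth[OF dT[OF x0(1)], of k] partial_inner_const[OF dF[OF x0(1)], of "t k"]
      by (simp add: T_def)
    also have "\<dots> = frechet_derivative F (at x0) v \<bullet> t k"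
      by (simp add: frechet_derivative_eq_sum_partial[OF dF[OF x0(1)]] inner_sum_left)
    finally show ?thesis .
  qed
  have "inj (frechet_derivative T (at x0))"
  proof (subst linear_injective_0[OF linear_frechet_derivative[OF dT[OF x0(1)]]], intro allI impI)
    fix v assume v: "frechet_derivative T (at x0) v = 0"
    let ?X = "frechet_derivative F (at x0) v"
    have "?X \<bullet> n = 0"
      by (simp add: frechet_derivative_eq_sum_partial[OF dF[OF x0(1)]] inner_sum_left n_def perp[OF x0(1)])
    moreover have "?X \<bullet> t k = 0" for k using DT[of v k] v by simp
    ultimately have "?X = 0" using t[of ?X ?X] by simp
    then show "v = 0"
      using inj[OF x0(1)] linear_injective_0[OF linear_frechet_derivative[OF dF[OF x0(1)]]] by blast
  qed
  from smooth_inverse_function[OF W T x0(1) this]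
  obtain W' V R where R: "open W'" "W' \<subseteq> W" "x0 \<in> W'" "open V" "T x0 \<in> V" "homeomorphism W' V T R"
    "\<And>k. smooth_on V (\<lambda>y. R y $ k)" by metis
  have RW': "R y \<in> W'" and TR: "T (R y) = y" if "y \<in> V" for y
    using R(6) that by (auto simp: homeomorphism_def)
  have RW: "R y \<in> W" if "y \<in> V" for y using RW'[OF that] R(2) by blast
  have RT: "R (T x) = x" "T x \<in> V" if "x \<in> W'" for x using R(6) that by (auto simp: homeomorphism_def)
  have Rimg: "R ` V \<subseteq> W" using RW by blast
  have dR: "R differentiable (at y)" if "y \<in> V" for y
    by (rule differentiable_vec) (rule smooth_on_differentiable[OF R(7) that])
  \<comment> \<open>The region where the normal still has a negative component along n, so that the
    factor S below stays positive.\<close>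
  define V0 where "V0 = {y \<in> V. \<nu> (R y) \<bullet> n < 0}"
  have "continuous_on V (\<lambda>y. \<nu> (R y) \<bullet> n)"
    using R(6) continuous_on_compose2[OF \<nu>(1) _ Rimg]
    by (intro continuous_intros) (auto simp: homeomorphism_def)
  then have "open (V \<inter> (\<lambda>y. \<nu> (R y) \<bullet> n) -` {..<0})"
    by (rule continuous_open_preimage[OF _ R(4)]) simp
  then have "open V0" by (simp add: V0_def Int_def vimage_def)
  have V0V: "V0 \<subseteq> V" by (auto simp: V0_def)
  define y0 where "y0 = T x0"
  have y0: "y0 \<in> V0" "R y0 = x0"
    using R(3,5) RT n1 by (auto simp: V0_def y0_def n_def power2_norm_eq_inner[symmetric])
  define u where "u y = F (R y) \<bullet> n" for y
  have u: "smooth_on V0 u"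
    unfolding u_def
    by (rule smooth_on_subset[OF smooth_on_compose[OF R(4) Rimg R(7) smooth_on_inner_const[OF F]] \<open>open V0\<close> V0V])
  define p where "p y = grad u y" for y
  define J where "J y = jacobian R y" for y
  \<comment> \<open>On V0 this is 1 / sqrt (1 + |p|^2); it cancels from the soliton
    equation.\<close>
  define S where "S y = - (\<nu> (R y) \<bullet> n)" for y
  have S: "0 < S y" if "y \<in> V0" for y using that by (simp add: V0_def S_def)
  have decomp: "F (R y) \<bullet> \<zeta> = (\<chi> k. \<zeta> \<bullet> t k) \<bullet> y + (\<zeta> \<bullet> n) * u y" if "y \<in> V" for y \<zeta>
  proof -
    have "F (R y) \<bullet> t k = y $ k" for k using TR[OF that] by (auto simp: T_def vec_eq_iff)
    then show ?thesis by (simp add: t[of "F (R y)" \<zeta>] u_def inner_vec_def[of _ y] mult.commute)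
  qed
  have key: "\<nu> (R y) \<bullet> t k = S y * p y $ k" "transpose (J y) ** second_form F \<nu> (R y) ** J y = S y *\<^sub>R hess u y"
    if y: "y \<in> V0" for y k
  proof -
    have yV: "y \<in> V" using y V0V by blast
    \<comment> \<open>With the normal frozen as \<zeta>, F . \<zeta> is in graph coordinates a
      linear function plus (\<zeta> . n) u. As it is critical at y, its gradient yields the normal
      in terms of \<open>grad u\<close>, and its Hessian compares the second form with
      \<open>hess u\<close>.\<close>
    define \<zeta> where "\<zeta> = \<nu> (R y)"
    define f where "f z = F z \<bullet> \<zeta>" for z
    define a where "a = (\<chi> k. \<zeta> \<bullet> t k)"
    have f: "smooth_on W f" unfolding f_def by (rule smooth_on_inner_const[OF F])
    have crit: "grad f (R y) = 0"
      unfolding f_def by (rule grad_normal_component[OF F RW[OF yV]]) (simp add: \<zeta>_def perp[OF RW[OF yV]])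
    have eq: "f (R z) = a \<bullet> z + (\<zeta> \<bullet> n) * u z" if "z \<in> V0" for z
      using decomp[of z \<zeta>] that V0V by (auto simp: f_def a_def)
    have peq: "partial (\<lambda>z. f (R z)) i z = partial (\<lambda>z. a \<bullet> z + (\<zeta> \<bullet> n) * u z) i z" if "z \<in> V0" for z i
      by (rule partial_cong[OF \<open>open V0\<close> that eq])
    have "partial (\<lambda>z. f (R z)) i y = 0" for i
      using partial_compose[OF dR[OF yV] smooth_on_differentiable[OF f RW[OF yV]]] crit
      by (simp add: grad_def vec_eq_iff)
    then have "a + (\<zeta> \<bullet> n) *\<^sub>R grad u y = 0"
      using hess_affine_plus(1)[OF u y, of a "\<zeta> \<bullet> n"] peq[OF y]
      by (simp add: grad_def[of "\<lambda>y. a \<bullet> y + (\<zeta> \<bullet> n) * u y"] vec_eq_iff)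
    then have "a $ k + (\<zeta> \<bullet> n) * grad u y $ k = 0" by (simp add: vec_eq_iff)
    then show "\<nu> (R y) \<bullet> t k = S y * p y $ k" by (simp add: a_def \<zeta>_def S_def p_def)
    have "partial (partial (\<lambda>z. f (R z)) j) i y = partial (partial (\<lambda>z. a \<bullet> z + (\<zeta> \<bullet> n) * u z) j) i y" for i j
      by (rule partial_cong[OF \<open>open V0\<close> y peq])
    then have "hess (\<lambda>z. f (R z)) y = (\<zeta> \<bullet> n) *\<^sub>R hess u y"
      using hess_affine_plus(2)[OF u y, of a "\<zeta> \<bullet> n"] by (simp add: hess_def)
    moreover have "hess (\<lambda>z. f (R z)) y = transpose (J y) ** hess f (R y) ** J y"
      unfolding J_def by (rule hess_compose_critical[OF R(4,7) Rimg f yV crit])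
    moreover have "hess f (R y) = - second_form F \<nu> (R y)"
      unfolding f_def \<zeta>_def using second_form_eq_hess[OF F RW[OF yV], of \<nu>] by simp
    moreover have "transpose (J y) ** (- second_form F \<nu> (R y)) ** J y = - (transpose (J y) ** second_form F \<nu> (R y) ** J y)"
      by (simp add: vec_eq_iff matrix_matrix_mult_def sum_negf sum_distrib_right)
    ultimately show "transpose (J y) ** second_form F \<nu> (R y) ** J y = S y *\<^sub>R hess u y"
      by (simp add: S_def \<zeta>_def eq_neg_iff_add_eq_0 neg_eq_iff_add_eq_0 add.commute)
  qed
  have metric: "transpose (J y) ** first_form F (R y) ** J y = mat 1 + (\<chi> i j. p y $ i * p y $ j)"
    if y: "y \<in> V0" for y
  proof -
    have yV: "y \<in> V" using y V0V by blast
    define G where "G y = F (R y)" for y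
    have dG: "G differentiable (at y)"
      unfolding G_def using differentiable_chain_at[OF dR[OF yV] dF[OF RW[OF yV]]] by (simp add: o_def)
    have "partial G i y \<bullet> t k = (if i = k then 1 else 0)" for i k
    proof -
      have "partial G i y \<bullet> t k = partial (\<lambda>z. G z \<bullet> t k) i y" by (simp add: partial_inner_const[OF dG])
      also have "\<dots> = partial (\<lambda>z. z $ k - 0) i y"
        by (rule partial_cong[OF R(4) yV]) (use TR in \<open>auto simp: G_def T_def vec_eq_iff\<close>)
      also have "\<dots> = (if i = k then 1 else 0)" unfolding partial_coordinate by auto
      finally show ?thesis .
    qed
    moreover have "partial G i y \<bullet> n = p y $ i" for i
      using partial_inner_const[OF dG, of n i] by (simp add: p_def grad_def u_def[abs_def] G_def)
    ultimately have "partial G i y \<bullet> partial G j y = (if i = j then 1 else 0) + p y $ i * p y $ j" for i j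
      using t[of "partial G i y" "partial G j y"]
      by (simp add: if_distrib[of "\<lambda>z. z * _"] cong: if_cong)
    then have "first_form G y = mat 1 + (\<chi> i j. p y $ i * p y $ j)"
      by (simp add: first_form_def vec_eq_iff mat_def)
    then show ?thesis
      using first_form_compose[OF dR[OF yV] dF[OF RW[OF yV]]] by (simp add: J_def G_def[abs_def])
  qed
  note tr = trace_inverse_graph_metric[OF metric key(2)]
  \<comment> \<open>By \<open>key\<close> the normal is S (p - n), with p read in the frame t; hence
    - b . \<nu> = S (b . n + c . p), where c is the tangential part of - b.\<close>
  define c where "c = - (\<chi> k. b \<bullet> t k)"
  have eqn: "graph_trace (grad u y) (hess u y) = (1 + grad u y \<bullet> grad u y) * (b \<bullet> n + c \<bullet> grad u y)"
    if y: "y \<in> V0" for y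
  proof -
    have yV: "y \<in> V" using y V0V by blast
    have "b \<bullet> \<nu> (R y) = - (S y * (b \<bullet> n + c \<bullet> p y))"
      unfolding t[of b "\<nu> (R y)"] key(1)[OF y]
      by (simp add: S_def c_def inner_vec_def[of _ "p y"] sum_distrib_left sum_negf algebra_simps)
    then have "trace (matrix_inv (first_form F (R y)) ** second_form F \<nu> (R y)) = S y * (b \<bullet> n + c \<bullet> p y)"
      using soliton[OF RW[OF yV]] by simp
    then have "S y * graph_trace (p y) (hess u y) = S y * ((1 + p y \<bullet> p y) * (b \<bullet> n + c \<bullet> p y))"
      unfolding tr(1)[OF y y, symmetric] by simp
    then show ?thesis using S[OF y] by (simp add: p_def)
  qed
  have hpsd: "0 \<le> v \<bullet> (hess u y *v v)" if y: "y \<in> V0" for y v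
  proof -
    have "0 \<le> v \<bullet> ((S y *\<^sub>R hess u y) *v v)"
      unfolding key(2)[OF y, symmetric] inner_congruent_matrix
      using y V0V by (intro psd RW) blast
    then show ?thesis using S[OF y] by (simp add: scaleR_matrix_vector_assoc[symmetric] zero_le_mult_iff)
  qed
  have degen: "det (second_form F \<nu> (R y)) = 0 \<longleftrightarrow> det (hess u y) = 0" if y: "y \<in> V0" for y
  proof -
    have "det (hess u y) = 0 \<longleftrightarrow> det (S y *\<^sub>R hess u y) = 0"
      using S[OF y] det_scaleR_eq_0_iff by (metis less_irrefl)
    also have "\<dots> \<longleftrightarrow> det (second_form F \<nu> (R y)) = 0"
      unfolding key(2)[OF y, symmetric] using tr(2)[OF y y] by (simp add: det_mul)
    finally show ?thesis by simp
  qed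
  obtain r where r: "0 < r" "ball y0 r \<subseteq> V0" using openE[OF \<open>open V0\<close> y0(1)] by blast
  have "det (hess u y0) = 0" using degen[OF y0(1)] y0(2) x0(2) by metis
  then have spread: "det (hess u y) = 0" if "y \<in> ball y0 (r / 2)" for y
    using degenerate_hessian_spreads[OF u eqn hpsd r(2) _ that] by blast
  let ?N = "W' \<inter> T -` ball y0 (r / 2)"
  show ?thesis
  proof (rule that[of ?N])
    have "continuous_on W' T" using R(6) by (simp add: homeomorphism_def)
    then show "open ?N" using R(1) by (intro continuous_open_preimage) auto
    show "x0 \<in> ?N" using R(3) r(1) by (simp add: y0_def)
    show "?N \<subseteq> W" using R(2) by blast
    fix x assume x: "x \<in> ?N"
    have xV0: "T x \<in> V0" using x r by (auto simp: subset_iff)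
    have "det (second_form F \<nu> (R (T x))) = 0" using spread[of "T x"] x degen[OF xV0] by blast
    then show "det (second_form F \<nu> x) = 0" using RT(1)[of x] x by simp
  qed
qed

section \<open>From charts to the whole manifold\<close>

lemma second_form_change_of_chart:
  fixes F \<nu> :: "real^'m \<Rightarrow> 'b::real_inner"
  assumes F: "smooth_on W F" and T: "smooth_on V T" "T ` V \<subseteq> W"
    and G: "\<And>y. y \<in> V \<Longrightarrow> G y = F (T y)" "\<And>y. y \<in> V \<Longrightarrow> \<nu>' y = \<nu> (T y)"
    and perp: "\<And>x i. x \<in> W \<Longrightarrow> partial F i x \<bullet> \<nu> x = 0" and y: "y \<in> V"
    and smG: "smooth_on V G"
  shows "second_form G \<nu>' y = transpose (jacobian T y) ** second_form F \<nu> (T y) ** jacobian T y"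
proof -
  have V: "open V" using T by (simp add: smooth_on_def)
  have x: "T y \<in> W" using T y by blast
  \<comment> \<open>Both charts see the same normal vector, so the two second forms are minus the
    Hessians of one scalar function in two coordinate systems, taken at a critical point.\<close>
  define \<zeta> where "\<zeta> = \<nu> (T y)"
  have "hess (\<lambda>z. G z \<bullet> \<zeta>) y = hess (\<lambda>z. F (T z) \<bullet> \<zeta>) y"
  proof -
    have 1: "partial (\<lambda>z. G z \<bullet> \<zeta>) i z = partial (\<lambda>z. F (T z) \<bullet> \<zeta>) i z" if "z \<in> V" for i z
      by (rule partial_cong[OF V that]) (simp add: G)
    show ?thesis
      unfolding hess_def vec_eq_iff by (simp, intro allI partial_cong[OF V y] 1)
  qed
  also have "\<dots> = transpose (jacobian T y) ** hess (\<lambda>z. F z \<bullet> \<zeta>) (T y) ** jacobian T y"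
    by (rule hess_compose_critical[OF V smooth_on_nth[OF T(1)] T(2) smooth_on_inner_const[OF F] y])
       (rule grad_normal_component[OF F x], simp add: \<zeta>_def perp[OF x])
  finally have "hess (\<lambda>z. G z \<bullet> \<zeta>) y = transpose (jacobian T y) ** hess (\<lambda>z. F z \<bullet> \<zeta>) (T y) ** jacobian T y" .
  moreover have "second_form G \<nu>' y = - hess (\<lambda>z. G z \<bullet> \<zeta>) y"
    using second_form_eq_hess[OF smG y, of \<nu>'] G(2)[OF y] by (simp add: \<zeta>_def)
  moreover have "second_form F \<nu> (T y) = - hess (\<lambda>z. F z \<bullet> \<zeta>) (T y)"
    using second_form_eq_hess[OF F x, of \<nu>] by (simp add: \<zeta>_def)
  ultimately show ?thesis
    by (simp add: vec_eq_iff matrix_matrix_mult_def sum_negf sum_distrib_right)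
qed

text \<open>The inverse metric contributes a nonzero determinant, so vanishing can be tested on the
  second form, which is continuous and changes by congruence.\<close>

lemma gauss_kronecker_eq_0_iff:
  assumes F: "smooth_on (\<phi> ` U) (f \<circ> inv_into U \<phi>)" and x: "x \<in> \<phi> ` U"
    and inj: "inj (frechet_derivative (f \<circ> inv_into U \<phi>) (at x))"
  shows "gauss_kronecker (U, \<phi>) f \<xi> x = 0 \<longleftrightarrow>
    det (second_form (f \<circ> inv_into U \<phi>) (\<xi> \<circ> inv_into U \<phi>) x) = 0"
proof -
  let ?g = "first_form (f \<circ> inv_into U \<phi>) x"
  have "det ?g \<noteq> 0" by (rule det_first_form[OF smooth_on_differentiable[OF F x] inj])
  then obtain B where "B ** ?g = mat 1" by (metis invertible_def invertible_det_nz)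
  then have "matrix_inv ?g ** ?g = mat 1" by (metis matrix_inv_eqI)
  then have "det (matrix_inv ?g) \<noteq> 0" by (metis det_I det_mul mult_zero_left zero_neq_one)
  then show ?thesis
    by (simp add: gauss_kronecker_def weingarten_mat_def det_mul metric_mat_def sff_mat_def
        first_form_def second_form_def)
qed

theorem theorem2p5:
  fixes \<A> :: "('a::{t2_space,second_countable_topology} set \<times> ('a \<Rightarrow> real^'m)) set"
    and f \<xi> :: "'a \<Rightarrow> real^('m + 1)"
  assumes "connected_manifold \<A>"
    and "translating_soliton \<A> f \<xi>"
    and "weakly_convex \<A> f \<xi>"
    and "\<exists>(U,\<phi>)\<in>\<A>. \<exists>p0\<in>U. gauss_kronecker (U,\<phi>) f \<xi> (\<phi> p0) = 0"
  shows "\<forall>(U,\<phi>)\<in>\<A>. \<forall>p\<in>U. gauss_kronecker (U,\<phi>) f \<xi> (\<phi> p) = 0"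
proof -
  define F where "F U \<phi> = f \<circ> inv_into U \<phi>" for U and \<phi> :: "'a \<Rightarrow> real^'m"
  define \<nu> where "\<nu> U \<phi> = \<xi> \<circ> inv_into U \<phi>" for U and \<phi> :: "'a \<Rightarrow> real^'m"
  define h where "h U \<phi> p = det (second_form (F U \<phi>) (\<nu> U \<phi>) (\<phi> p))" for U \<phi> p
  have atlas: "smooth_atlas \<A>" and conn: "connected (UNIV :: 'a set)"
    using assms(1) by (auto simp: connected_manifold_def)
  have imm: "oriented_immersion \<A> f \<xi>" using assms(2) by (simp add: translating_soliton_def)
  have cover: "\<exists>U \<phi>. (U, \<phi>) \<in> \<A> \<and> p \<in> U" for p
  proof -
    have "p \<in> (\<Union>(U, \<phi>)\<in>\<A>. U)" using atlas by (simp add: smooth_atlas_def)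
    then show ?thesis by auto
  qed
  have \<xi>: "continuous_on UNIV \<xi>" "norm (\<xi> p) = 1" for p
    using imm by (auto simp: oriented_immersion_def)
  have chart: "open U" "homeomorphism U (\<phi> ` U) \<phi> (inv_into U \<phi>)" "smooth_on (\<phi> ` U) (F U \<phi>)"
    if "(U, \<phi>) \<in> \<A>" for U \<phi>
    using atlas imm that by (auto simp: smooth_atlas_def oriented_immersion_def F_def)
  have inv: "inv_into U \<phi> (\<phi> p) = p" if "(U, \<phi>) \<in> \<A>" "p \<in> U" for U \<phi> p
    using chart(2)[OF that(1)] that(2) by (auto simp: homeomorphism_def)
  have inj: "inj (frechet_derivative (F U \<phi>) (at x))" and perp: "partial (F U \<phi>) i x \<bullet> \<nu> U \<phi> x = 0"
    if "(U, \<phi>) \<in> \<A>" "x \<in> \<phi> ` U" for U \<phi> x i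
    using imm that by (auto simp: oriented_immersion_def F_def \<nu>_def)
  have cont_\<nu>: "continuous_on (\<phi> ` U) (\<nu> U \<phi>)" if "(U, \<phi>) \<in> \<A>" for U \<phi>
    unfolding \<nu>_def using chart(2)[OF that]
    by (intro continuous_on_compose continuous_on_subset[OF \<xi>(1)]) (auto simp: homeomorphism_def)
  have gk: "gauss_kronecker (U, \<phi>) f \<xi> (\<phi> p) = 0 \<longleftrightarrow> h U \<phi> p = 0" if "(U, \<phi>) \<in> \<A>" "p \<in> U" for U \<phi> p
    using gauss_kronecker_eq_0_iff[of \<phi> U f "\<phi> p" \<xi>] chart(3)[OF that(1)] inj[OF that(1)] that(2)
    by (simp add: h_def F_def \<nu>_def)
  \<comment> \<open>A change of chart multiplies the second form on both sides by a Jacobian or its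
    transpose, so a zero determinant stays zero.\<close>
  have indep: "h U' \<phi>' p = 0" if C: "(U, \<phi>) \<in> \<A>" "(U', \<phi>') \<in> \<A>" and p: "p \<in> U" "p \<in> U'" "h U \<phi> p = 0"
    for U U' \<phi> \<phi>' p
  proof -
    let ?T = "\<phi> \<circ> inv_into U' \<phi>'" and ?V = "\<phi>' ` (U' \<inter> U)"
    have T: "smooth_on ?V ?T" using atlas C by (fastforce simp: smooth_atlas_def)
    have img: "?T ` ?V \<subseteq> \<phi> ` U" using inv[OF C(2)] by auto
    have V: "open ?V" "?V \<subseteq> \<phi>' ` U'" using T by (auto simp: smooth_on_def)
    have "second_form (F U' \<phi>') (\<nu> U' \<phi>') (\<phi>' p) = transpose (jacobian ?T (\<phi>' p)) **
        second_form (F U \<phi>) (\<nu> U \<phi>) (?T (\<phi>' p)) ** jacobian ?T (\<phi>' p)"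
      by (rule second_form_change_of_chart[OF chart(3)[OF C(1)] T img _ _ perp[OF C(1)] _
            smooth_on_subset[OF chart(3)[OF C(2)] V]])
         (use inv[OF C(1)] inv[OF C(2)] p in \<open>auto simp: F_def \<nu>_def\<close>)
    then show ?thesis using p inv[OF C(2)] by (simp add: h_def det_mul)
  qed
  \<comment> \<open>Both sets ask for some chart only, so that openness can be verified in the chart
    at hand; that they are disjoint is exactly \<open>indep\<close>.\<close>
  define Z where "Z = {p. \<exists>U \<phi>. (U, \<phi>) \<in> \<A> \<and> p \<in> U \<and> h U \<phi> p = 0}"
  define Y where "Y = {p. \<exists>U \<phi>. (U, \<phi>) \<in> \<A> \<and> p \<in> U \<and> h U \<phi> p \<noteq> 0}"
  have "open Z"
  proof (subst open_subopen, intro ballI)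
    fix p assume "p \<in> Z"
    then obtain U \<phi> where C: "(U, \<phi>) \<in> \<A>" "p \<in> U" "h U \<phi> p = 0" by (auto simp: Z_def)
    have sol: "trace (matrix_inv (first_form (F U \<phi>) x) ** second_form (F U \<phi>) (\<nu> U \<phi>) x) = - (e_last \<bullet> \<nu> U \<phi> x)"
      and psd: "0 \<le> v \<bullet> (second_form (F U \<phi>) (\<nu> U \<phi>) x *v v)" if x: "x \<in> \<phi> ` U" for x v
    proof -
      obtain q where q: "q \<in> U" "x = \<phi> q" using x by blast
      have "mean_curv (U, \<phi>) f \<xi> (\<phi> q) = - (e_last \<bullet> \<xi> q)"
        using assms(2) C(1) q(1) by (auto simp: translating_soliton_def)
      then show "trace (matrix_inv (first_form (F U \<phi>) x) ** second_form (F U \<phi>) (\<nu> U \<phi>) x) = - (e_last \<bullet> \<nu> U \<phi> x)"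
        using inv[OF C(1) q(1)]
        by (simp add: q(2) mean_curv_def weingarten_mat_def metric_mat_def sff_mat_def first_form_def
            second_form_def F_def \<nu>_def)
      have "0 \<le> v \<bullet> (sff_mat (U, \<phi>) f \<xi> (\<phi> q) *v v)"
        using assms(3) C(1) q(1) by (auto simp: weakly_convex_def)
      then show "0 \<le> v \<bullet> (second_form (F U \<phi>) (\<nu> U \<phi>) x *v v)"
        by (simp add: q(2) sff_mat_def second_form_def F_def \<nu>_def)
    qed
    have n1: "norm (\<nu> U \<phi> x) = 1" for x by (simp add: \<nu>_def \<xi>(2))
    have "\<phi> p \<in> \<phi> ` U" "det (second_form (F U \<phi>) (\<nu> U \<phi>) (\<phi> p)) = 0"
      using C by (auto simp: h_def)
    from soliton_degeneracy_open[OF chart(3)[OF C(1)] inj[OF C(1)] cont_\<nu>[OF C(1)] n1 perp[OF C(1)] sol psd this]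
    obtain N where N: "open N" "\<phi> p \<in> N" "N \<subseteq> \<phi> ` U"
      "\<And>x. x \<in> N \<Longrightarrow> det (second_form (F U \<phi>) (\<nu> U \<phi>) x) = 0" by metis
    have "open (U \<inter> \<phi> -` N)"
      using chart(1,2)[OF C(1)] N(1) by (intro continuous_open_preimage) (auto simp: homeomorphism_def)
    moreover have "p \<in> U \<inter> \<phi> -` N" using C N by simp
    moreover have "U \<inter> \<phi> -` N \<subseteq> Z"
      using C(1) N(4) by (auto simp: Z_def h_def)
    ultimately show "\<exists>T. open T \<and> p \<in> T \<and> T \<subseteq> Z" by blast
  qed
  moreover have "open Y"
  proof (subst open_subopen, intro ballI)
    fix p assume "p \<in> Y"
    then obtain U \<phi> where C: "(U, \<phi>) \<in> \<A>" "p \<in> U" "h U \<phi> p \<noteq> 0" by (auto simp: Y_def)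
    have det: "continuous_on (\<phi> ` U) (\<lambda>x. det (second_form (F U \<phi>) (\<nu> U \<phi>) x))"
      unfolding det_def second_form_def
      by (simp, intro continuous_intros cont_\<nu>[OF C(1)]
          smooth_on_continuous_on[OF smooth_on_partial[OF smooth_on_partial[OF chart(3)[OF C(1)]]]])
    have "continuous_on U \<phi>" using chart(2)[OF C(1)] by (simp add: homeomorphism_def)
    from continuous_on_compose2[OF det this order_refl] have "continuous_on U (h U \<phi>)"
      by (simp add: h_def[abs_def])
    then have "open (U \<inter> h U \<phi> -` (- {0}))"
      using chart(1)[OF C(1)] by (intro continuous_open_preimage) auto
    moreover have "p \<in> U \<inter> h U \<phi> -` (- {0})" using C by simp
    moreover have "U \<inter> h U \<phi> -` (- {0}) \<subseteq> Y" using C(1) by (auto simp: Y_def)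
    ultimately show "\<exists>T. open T \<and> p \<in> T \<and> T \<subseteq> Y" by blast
  qed
  moreover have "Z \<inter> Y \<inter> UNIV = {}" using indep unfolding Z_def Y_def by blast
  moreover have "UNIV \<subseteq> Z \<union> Y" using cover unfolding Z_def Y_def by blast
  ultimately have "Z \<inter> UNIV = {} \<or> Y \<inter> UNIV = {}" using connectedD[OF conn] by blast
  moreover have "Z \<noteq> {}"
  proof -
    obtain U \<phi> p where C: "(U, \<phi>) \<in> \<A>" "p \<in> U" "gauss_kronecker (U, \<phi>) f \<xi> (\<phi> p) = 0"
      using assms(4) by blast
    then have "p \<in> Z" using gk[OF C(1,2)] by (auto simp: Z_def)
    then show ?thesis by blast
  qed
  ultimately have "Y = {}" by blast
  then show ?thesis using gk unfolding Y_def by blast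
qed

end
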